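(* Let $m$ be an integer with $m \geq 2^{3n/\log n}$. There is a (randomized) algorithm that takes as input a linear system $(A,b)\in\mathbb{F}_2^{m\times n}\times\mathbb{F}_2^m$ with $m$ equations and in $\mathrm{poly}(m)$ time outputs a quantity $\mathcal{V}\in[\frac12,1]$ such that: (1) $\mathrm{val}(A,b)\leq\mathcal{V}$ (for every input $(A,b)$); (2) if $(A,b)$ is a semirandom linear system, then for all $2^{-n^{1/20}}\leq\varepsilon\leq\frac12$ we have $\mathcal{V}\leq\frac12+\varepsilon$ with high probability.
   Context: A linear system in $\mathbb{F}_2^n$ with $m$ equations is a pair $(A,b)\in\mathbb{F}_2^{m\times n}\times\mathbb{F}_2^m$, representing the equations $\langle a_i,x\rangle=b_i$, $i\in[m]$, where $a_i$ is the $i$-th row of $A$. Its value $\mathrm{val}(A,b)$ is the maximum over $x\in\mathbb{F}_2^n$ of the fraction of $i\in[m]$ with $\langle a_i,x\rangle=b_i$. The system $(A,b)$ is semirandom if $A$ is arbitrary and $b$ is uniformly random in $\mathbb{F}_2^m$, independent of $A$. Logarithms are base 2. "With high probability" means with probability $1-o(1)$ as $n\to\infty$, over the draw of $b$ and the internal randomness of the algorithm. *)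

theory Defs
  imports
    "HOL-Probability.Probability_Mass_Function"
    "HOL-Computational_Algebra.Polynomial"
    "HOL-Library.Z2"
    "Jordan_Normal_Form.Matrix"
begin

text \<open>
  \<open>bit\<close> is the field with two elements. A linear system with \<open>m\<close> equations in \<open>n\<close> unknowns is a pair
  of \<open>A \<in> carrier_mat m n\<close> and \<open>b \<in> carrier_vec m\<close>.
\<close>

definition val :: "bit mat \<Rightarrow> bit vec \<Rightarrow> real" where
  "val A b =
     Max ((\<lambda>x. real (card {i. i < dim_row A \<and> scalar_prod (row A i) x = vec_index b i}) / real (dim_row A))
            ` carrier_vec (dim_col A))"

section \<open>Randomized algorithms: a structured random access machine\<close>

text \<open>
  Programs act on named registers and named arrays of natural numbers. The machine model is the unit-cost
  RAM whose arithmetic consists of addition and truncated subtraction only. Each time unit increases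
  the bit length of the largest stored number by at most a constant depending on the program, so this cost measure is
  polynomially equivalent to Turing machine time. This would fail with a unit-cost multiplication.
\<close>

datatype aexp =
    Const nat
  | Reg string
  | Read string aexp
  | Plus aexp aexp
  | Minus aexp aexp

datatype bexp =
    Less aexp aexp
  | Equal aexp aexp
  | Neg bexp
  | Conj bexp bexp

datatype com =
    Skip
  | Assign string aexp
  | Write string aexp aexp
  | Flip string
  | Seq com com
  | Cond bexp com com
  | While bexp com

text \<open>The third component holds the internal random bits that have not been consumed yet.\<close>

datatype config =
  Config (regs: "string \<Rightarrow> nat") (arrs: "string \<Rightarrow> nat \<Rightarrow> nat") (coins: "bool list")

fun aval :: "aexp \<Rightarrow> config \<Rightarrow> nat" where
  "aval (Const k) c = k"
| "aval (Reg x) c = regs c x"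
| "aval (Read a e) c = arrs c a (aval e c)"
| "aval (Plus e1 e2) c = aval e1 c + aval e2 c"
| "aval (Minus e1 e2) c = aval e1 c - aval e2 c"

fun bval :: "bexp \<Rightarrow> config \<Rightarrow> bool" where
  "bval (Less e1 e2) c \<longleftrightarrow> aval e1 c < aval e2 c"
| "bval (Equal e1 e2) c \<longleftrightarrow> aval e1 c = aval e2 c"
| "bval (Neg b) c \<longleftrightarrow> \<not> bval b c"
| "bval (Conj b1 b2) c \<longleftrightarrow> bval b1 c \<and> bval b2 c"

fun acost :: "aexp \<Rightarrow> nat" where
  "acost (Const k) = 1"
| "acost (Reg x) = 1"
| "acost (Read a e) = 1 + acost e"
| "acost (Plus e1 e2) = 1 + acost e1 + acost e2"
| "acost (Minus e1 e2) = 1 + acost e1 + acost e2"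

fun bcost :: "bexp \<Rightarrow> nat" where
  "bcost (Less e1 e2) = 1 + acost e1 + acost e2"
| "bcost (Equal e1 e2) = 1 + acost e1 + acost e2"
| "bcost (Neg b) = 1 + bcost b"
| "bcost (Conj b1 b2) = 1 + bcost b1 + bcost b2"

text \<open>
  \<open>exec p c t c'\<close>: started in \<open>c\<close>, the program \<open>p\<close> halts in \<open>c'\<close> after exactly \<open>t\<close> time units.
  A \<open>Flip\<close> without any random bit left does not halt.
\<close>

inductive exec :: "com \<Rightarrow> config \<Rightarrow> nat \<Rightarrow> config \<Rightarrow> bool" where
  Skip: "exec Skip c 1 c"
| Assign: "exec (Assign x e) c (1 + acost e)
             (Config ((regs c)(x := aval e c)) (arrs c) (coins c))"
| Write: "exec (Write a e1 e2) c (1 + acost e1 + acost e2)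
            (Config (regs c) ((arrs c)(a := (arrs c a)(aval e1 c := aval e2 c))) (coins c))"
| Flip: "coins c = r # rs \<Longrightarrow>
           exec (Flip x) c 1 (Config ((regs c)(x := of_bool r)) (arrs c) rs)"
| Seq: "exec p c t1 c1 \<Longrightarrow> exec q c1 t2 c2 \<Longrightarrow> exec (Seq p q) c (t1 + t2) c2"
| CondTrue: "bval b c \<Longrightarrow> exec p c t c1 \<Longrightarrow> exec (Cond b p q) c (bcost b + t) c1"
| CondFalse: "\<not> bval b c \<Longrightarrow> exec q c t c1 \<Longrightarrow> exec (Cond b p q) c (bcost b + t) c1"
| WhileFalse: "\<not> bval b c \<Longrightarrow> exec (While b p) c (bcost b) c"
| WhileTrue: "bval b c \<Longrightarrow> exec p c t1 c1 \<Longrightarrow> exec (While b p) c1 t2 c2 \<Longrightarrow>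
                exec (While b p) c (bcost b + t1 + t2) c2"

inductive_cases SkipE: "exec Skip c t c'"
inductive_cases AssignE: "exec (Assign x e) c t c'"
inductive_cases WriteE: "exec (Write a e1 e2) c t c'"
inductive_cases FlipE: "exec (Flip x) c t c'"
inductive_cases SeqE: "exec (Seq p q) c t c'"
inductive_cases CondE: "exec (Cond b p q) c t c'"
inductive_cases WhileE: "exec (While b p) c t c'"

lemma exec_deterministic:
  "exec p c t c1 \<Longrightarrow> exec p c t' c2 \<Longrightarrow> t = t' \<and> c1 = c2"
proof (induction arbitrary: t' c2 rule: exec.induct)
  case (Skip c)
  from Skip.prems show ?case by (auto elim: SkipE)
next
  case (Assign x e c)
  from Assign.prems show ?case by (auto elim: AssignE)
next
  case (Write a e1 e2 c)
  from Write.prems show ?case by (auto elim: WriteE)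
next
  case (Flip c r rs x)
  from Flip.prems Flip.hyps show ?case by (auto elim: FlipE)
next
  case (Seq p c t1 c1 q t2 c2')
  from Seq.prems show ?case by (rule SeqE) (use Seq.IH in blast)+
next
  case (CondTrue b c p t c1 q)
  from CondTrue.prems show ?case by (rule CondE) (use CondTrue.IH CondTrue.hyps in blast)+
next
  case (CondFalse b c q t c1 p)
  from CondFalse.prems show ?case by (rule CondE) (use CondFalse.IH CondFalse.hyps in blast)+
next
  case (WhileFalse b c p)
  from WhileFalse.prems show ?case by (rule WhileE) (use WhileFalse.hyps in blast)+
next
  case (WhileTrue b c p t1 c1 t2 c2')
  from WhileTrue.prems show ?case by (rule WhileE) (use WhileTrue.IH WhileTrue.hyps in blast)+
qed

text \<open>
  The system \<open>(A, b)\<close> is stored as 0/1 values, the matrix in row-major order; everything else is zero.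
\<close>

definition input :: "bit mat \<Rightarrow> bit vec \<Rightarrow> bool list \<Rightarrow> config" where
  "input A b r = Config
     ((\<lambda>_. 0)(''m'' := dim_row A, ''n'' := dim_col A))
     ((\<lambda>_ _. 0)
        (''A'' := (\<lambda>k. of_bool (k < dim_row A * dim_col A \<and> A $$ (k div dim_col A, k mod dim_col A) = 1)),
         ''b'' := (\<lambda>i. of_bool (i < dim_vec b \<and> vec_index b i = 1))))
     r"

text \<open>
  \<open>outputs p A b r t v\<close>: on input \<open>(A, b)\<close> and internal random bits \<open>r\<close>, the program halts after \<open>t\<close>
  time units with output \<open>v\<close>, given as a numerator and a denominator.
\<close>

definition outputs :: "com \<Rightarrow> bit mat \<Rightarrow> bit vec \<Rightarrow> bool list \<Rightarrow> nat \<Rightarrow> real \<Rightarrow> bool" where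
  "outputs p A b r t v \<longleftrightarrow>
     (\<exists>c. exec p (input A b r) t c \<and> regs c ''den'' \<noteq> 0 \<and>
          v = real (regs c ''num'') / real (regs c ''den''))"

text \<open>
  Joint distribution of a uniformly random right-hand side in \<open>\<bbbF>\<^sub>2\<^sup>m\<close> and \<open>l\<close> independent fair internal
  random bits. A program that halts within \<open>l\<close> time units cannot consume more than \<open>l\<close> of them.
\<close>

definition rhs_and_coins :: "nat \<Rightarrow> nat \<Rightarrow> (bit vec \<times> bool list) pmf" where
  "rhs_and_coins m l = pair_pmf (pmf_of_set (carrier_vec m)) (pmf_of_set {r. length r = l})"

end

theory Submission
  imports Defs "HOL-Real_Asymp.Real_Asymp"
begin

text \<open>
  The certificate comes from a deterministic, chunked variant of the Blum-Kalai-Wasserman reduction. Write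
  \<open>F x\<close> for the sum of the signs \<open>(-1) ^ (\<langle>a\<^sub>i, x\<rangle> + b\<^sub>i)\<close>. Group the equations by their first block of \<open>p\<close>
  coordinates, cut each group into chunks of size \<open>s\<close>, and apply Cauchy-Schwarz to the sum of the chunk
  sums: \<open>(F x)\<^sup>2\<close> is at most the number of chunks times the diagonal plus twice the sum of the signs of
  all pairs within chunks, and the sums of these pairs of equations vanish on the first block. After \<open>L\<close>
  rounds all combined equations have left-hand side \<open>0\<close>, so the final sum of signs depends only on \<open>b\<close>;
  if it is small, then \<open>F x\<close> is small for all \<open>x\<close>.

  For random \<open>b\<close> the final sum has a small second moment. The pair at positions \<open>i, j\<close> of a chunk gets
  the label \<open>i + j\<close>; combinations that share all their labels use disjoint sets of equations, so their
  signs are uncorrelated, and there are only \<open>(2 s) ^ L\<close> sequences of labels.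

  With \<open>2 ^ L\<close> about \<open>n ^ (2/5)\<close> and \<open>s = 2 ^ (2 ^ L * 2 ^ L)\<close>, the bias that is certified is of order
  \<open>2 powr - (n powr (2/5))\<close>, and \<open>m \<ge> 2 powr (3 n / log n)\<close> equations suffice as \<open>p = n / L\<close>.
\<close>

section \<open>Cauchy-Schwarz over chunks of indices with equal key\<close>

section \<open>Buckets\<close>

lemma sum_symmetric_split:
  fixes g :: "nat \<Rightarrow> nat \<Rightarrow> real"
  assumes "\<And>i j. g i j = g j i"
  shows "(\<Sum>i<N. \<Sum>j<N. g i j) = (\<Sum>i<N. g i i) + 2 * (\<Sum>i<N. \<Sum>u<i. g u i)"
proof (induction N)
  case (Suc N)
  have "(\<Sum>i<Suc N. \<Sum>j<Suc N. g i j) =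
      (\<Sum>i<N. \<Sum>j<N. g i j) + (\<Sum>i<N. g i N) + (\<Sum>j<N. g N j) + g N N"
    by (simp add: sum.distrib)
  also have "(\<Sum>j<N. g N j) = (\<Sum>i<N. g i N)"
    using assms by simp
  finally show ?case
    using Suc by simp
qed simp

text \<open>Cauchy-Schwarz over the nonempty buckets. When the squared bucket sums are expanded, the
  diagonal gives 1 per index because \<open>f i\<close> is a sign, and symmetry counts every
  unordered pair twice.\<close>

lemma square_sum_le_buckets:
  fixes f :: "nat \<Rightarrow> real"
  assumes "\<And>i. i < N \<Longrightarrow> (f i)\<^sup>2 = 1"
  shows "(\<Sum>i<N. f i)\<^sup>2 \<le>
    card (\<beta> ` {..<N}) * (N + 2 * (\<Sum>i<N. \<Sum>u<i. if \<beta> u = \<beta> i then f u * f i else 0))"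
proof -
  let ?C = "\<lambda>B. {i \<in> {..<N}. \<beta> i = B}"
  let ?a = "\<lambda>B. \<Sum>i\<in>?C B. f i"
  let ?g = "\<lambda>i j. if \<beta> i = \<beta> j then f i * f j else 0"
  have "(\<Sum>i<N. f i) = (\<Sum>B\<in>\<beta> ` {..<N}. ?a B)"
    by (rule sum.image_gen) simp
  then have "(\<Sum>i<N. f i)\<^sup>2 \<le> (\<Sum>B\<in>\<beta> ` {..<N}. (?a B)\<^sup>2) * card (\<beta> ` {..<N})"
    using sum_squared_le_sum_of_squares[of ?a "\<beta> ` {..<N}"] by simp
  also have "(\<Sum>B\<in>\<beta> ` {..<N}. (?a B)\<^sup>2) = (\<Sum>B\<in>\<beta> ` {..<N}. \<Sum>i\<in>?C B. \<Sum>j<N. ?g i j)"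
  proof (rule sum.cong[OF refl])
    fix B
    have "(?a B)\<^sup>2 = (\<Sum>i\<in>?C B. \<Sum>j\<in>?C B. f i * f j)"
      by (simp add: power2_eq_square sum_product)
    also have "\<dots> = (\<Sum>i\<in>?C B. \<Sum>j<N. ?g i j)"
    proof (rule sum.cong[OF refl])
      fix i assume "i \<in> ?C B"
      then show "(\<Sum>j\<in>?C B. f i * f j) = (\<Sum>j<N. ?g i j)"
        by (intro sum.mono_neutral_cong_left) auto
    qed
    finally show "(?a B)\<^sup>2 = (\<Sum>i\<in>?C B. \<Sum>j<N. ?g i j)" .
  qed
  also have "\<dots> = (\<Sum>i<N. \<Sum>j<N. ?g i j)"
    by (rule sum.image_gen[symmetric]) simp
  also have "\<dots> = (\<Sum>i<N. ?g i i) + 2 * (\<Sum>i<N. \<Sum>u<i. ?g u i)"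
    by (rule sum_symmetric_split) auto
  also have "(\<Sum>i<N. ?g i i) = N"
    using assms by (simp add: power2_eq_square)
  finally show ?thesis
    by (simp add: mult.commute)
qed

definition class_rank :: "(nat \<Rightarrow> 'k) \<Rightarrow> nat \<Rightarrow> nat" where
  "class_rank key i = card {u. u < i \<and> key u = key i}"

text \<open>Each key class, in increasing order, is cut into chunks of \<open>s\<close> consecutive
  members; \<open>class_rank key i mod s\<close> is the position inside the chunk. Chunks of bounded
  size keep the number of pairs below \<open>s * N\<close>.\<close>

definition bucket :: "(nat \<Rightarrow> 'k) \<Rightarrow> nat \<Rightarrow> nat \<Rightarrow> 'k \<times> nat" where
  "bucket key s i = (key i, class_rank key i div s)"

lemma class_rank_less: "u < i \<Longrightarrow> key u = key i \<Longrightarrow> class_rank key u < class_rank key i"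
  unfolding class_rank_def by (intro psubset_card_mono) auto

lemma class_rank_inject: "key u = key i \<Longrightarrow> class_rank key u = class_rank key i \<Longrightarrow> u = i"
  using class_rank_less[of u i key] class_rank_less[of i u key] by (metis less_irrefl linorder_neqE_nat)

lemma bucket_position_inject:
  "bucket key s u = bucket key s i \<Longrightarrow> class_rank key u mod s = class_rank key i mod s \<Longrightarrow> u = i"
  unfolding bucket_def by (metis Pair_inject div_mult_mod_eq class_rank_inject)

lemma card_bucket_le:
  assumes "s > 0"
  shows "card {u. u < i \<and> bucket key s u = bucket key s i} \<le> s"
proof -
  have "card {u. u < i \<and> bucket key s u = bucket key s i} \<le> card {..<s}"
    by (rule card_inj_on_le[where f = "\<lambda>u. class_rank key u mod s"])
      (use assms in \<open>auto intro!: inj_onI intro: bucket_position_inject[of key s]\<close>)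
  then show ?thesis by simp
qed

text \<open>A class of size \<open>k\<close> meets at most \<open>k div s + 1\<close> chunks, so
  rounding costs one chunk per key value, which is \<open>s\<close> after scaling.\<close>

lemma number_of_buckets:
  assumes "s > 0"
  shows "card (bucket key s ` {..<N}) * s \<le> N + s * card (key ` {..<N})"
proof -
  let ?K = "key ` {..<N}"
  let ?n = "\<lambda>k. card {i \<in> {..<N}. key i = k}"
  have "bucket key s ` {..<N} \<subseteq> Sigma ?K (\<lambda>k. {..?n k div s})"
  proof
    fix B assume "B \<in> bucket key s ` {..<N}"
    then obtain i where i: "i < N" "B = bucket key s i" by auto
    have "class_rank key i \<le> ?n (key i)"
      unfolding class_rank_def by (intro card_mono) (use i in auto)
    then show "B \<in> Sigma ?K (\<lambda>k. {..?n k div s})"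
      using i by (auto simp: bucket_def div_le_mono)
  qed
  then have "card (bucket key s ` {..<N}) \<le> card (Sigma ?K (\<lambda>k. {..?n k div s}))"
    by (intro card_mono) auto
  also have "\<dots> = (\<Sum>k\<in>?K. ?n k div s + 1)"
    by simp
  finally have "card (bucket key s ` {..<N}) * s \<le> (\<Sum>k\<in>?K. (?n k div s + 1) * s)"
    using mult_le_mono1[of _ _ s] by (simp only: sum_distrib_right[symmetric])
  also have "\<dots> \<le> (\<Sum>k\<in>?K. ?n k + s)"
    by (intro sum_mono) (simp add: add.commute)
  also have "\<dots> = (\<Sum>k\<in>?K. ?n k) + s * card ?K"
    by (simp add: sum.distrib)
  also have "(\<Sum>k\<in>?K. ?n k) = N"
    using sum.image_gen[of "{..<N}" "\<lambda>_. 1::nat" key] by simp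
  finally show ?thesis .
qed

text \<open>The order, by larger index and then by smaller index, is the one in which
  \<open>emit_loop\<close> appends combinations, so the list can be compared with memory cell by
  cell.\<close>

definition pairs :: "(nat \<Rightarrow> 'k) \<Rightarrow> nat \<Rightarrow> nat \<Rightarrow> (nat \<times> nat) list" where
  "pairs key s N = concat (map (\<lambda>i. map (\<lambda>u. (u, i))
     (filter (\<lambda>u. bucket key s u = bucket key s i) [0..<i])) [0..<N])"

lemma pairs_Suc: "pairs key s (Suc N) = pairs key s N @
    map (\<lambda>u. (u, N)) (filter (\<lambda>u. bucket key s u = bucket key s N) [0..<N])"
  by (simp add: pairs_def)

lemma pairs_0 [simp]: "pairs key s 0 = []"
  by (simp add: pairs_def)

lemma in_pairs: "(u, i) \<in> set (pairs key s N) \<longleftrightarrow> u < i \<and> i < N \<and> bucket key s u = bucket key s i"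
  by (induction N) (auto simp: pairs_Suc less_Suc_eq)

lemma distinct_pairs: "distinct (pairs key s N)"
  by (induction N) (auto simp: pairs_Suc distinct_map inj_on_def in_pairs)

lemma length_pairs:
  assumes "s > 0"
  shows "length (pairs key s N) \<le> s * N"
proof (induction N)
  case (Suc N)
  have "length (filter (\<lambda>u. bucket key s u = bucket key s N) [0..<N]) =
      card {u. u < N \<and> bucket key s u = bucket key s N}"
    by (subst distinct_card[symmetric]) (auto intro!: arg_cong[where f = card])
  then show ?case
    using Suc card_bucket_le[OF assms, of N key] by (simp add: pairs_Suc)
qed simp

lemma sum_pairs:
  fixes f :: "nat \<Rightarrow> nat \<Rightarrow> real"
  shows "(\<Sum>(u, i)\<leftarrow>pairs key s N. f u i) =
    (\<Sum>i<N. \<Sum>u<i. if bucket key s u = bucket key s i then f u i else 0)"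
proof (induction N)
  case (Suc N)
  have "(\<Sum>u\<leftarrow>filter P [0..<k]. f u N) = (\<Sum>u<k. if P u then f u N else 0)" for P k
    by (induction k) auto
  then show ?case
    using Suc by (simp add: pairs_Suc o_def)
qed simp

section \<open>Signs\<close>

definition sg :: "bit \<Rightarrow> real" where
  "sg a = (if a = 0 then 1 else - 1)"

lemma sg_0 [simp]: "sg 0 = 1"
  by (simp add: sg_def)

lemma sg_add: "sg (a + b) = sg a * sg b"
  by (cases a; cases b) (simp_all add: sg_def)

lemma sg_square [simp]: "(sg a)\<^sup>2 = 1"
  by (simp add: sg_def)

section \<open>Levels of combined equations and their labels\<close>

section \<open>Levels\<close>

text \<open>
  A combination \<open>(t, S)\<close> stands for the sum of the equations listed in \<open>S\<close>. The number \<open>t\<close> encodes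
  its sequence of labels in base \<open>2 s\<close>.
\<close>

type_synonym combination = "nat \<times> nat list"

definition coord :: "bit mat \<Rightarrow> combination \<Rightarrow> nat \<Rightarrow> bit" where
  "coord A T k = (\<Sum>i\<leftarrow>snd T. A $$ (i, k))"

definition rhs :: "bit vec \<Rightarrow> combination \<Rightarrow> bit" where
  "rhs b T = (\<Sum>i\<leftarrow>snd T. vec_index b i)"

text \<open>The bits of the block are appended to the identifier. Equal keys therefore mean equal
  label histories as well as equal coordinates in the block, which is what preserves
  \<open>separated\<close>.\<close>

definition block_key :: "bit mat \<Rightarrow> nat \<Rightarrow> nat \<Rightarrow> combination \<Rightarrow> nat" where
  "block_key A k k' T = foldl (\<lambda>a k. 2 * a + of_bool (coord A T k = 1)) (fst T) [k..<k']"

text \<open>The paired members share their identifier, so that of \<open>i\<close> serves for both.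
  With \<open>W = (2 * s) ^ l\<close> the sum of the two positions becomes the next digit in base
  \<open>2 * s\<close>. Using the sum instead of the pair of positions keeps the number of labels
  linear in \<open>s\<close>. The two products stay separate because the program adds premultiplied
  positions.\<close>

definition combine :: "(combination \<Rightarrow> nat) \<Rightarrow> nat \<Rightarrow> nat \<Rightarrow> combination list \<Rightarrow> nat \<times> nat \<Rightarrow> combination" where
  "combine key s W xs = (\<lambda>(u, i).
     (fst (xs ! i) + (W * (class_rank (\<lambda>i. key (xs ! i)) u mod s) + W * (class_rank (\<lambda>i. key (xs ! i)) i mod s)),
      snd (xs ! u) @ snd (xs ! i)))"

definition step :: "(combination \<Rightarrow> nat) \<Rightarrow> nat \<Rightarrow> nat \<Rightarrow> combination list \<Rightarrow> combination list" where
  "step key s W xs = map (combine key s W xs) (pairs (\<lambda>i. key (xs ! i)) s (length xs))"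

fun level :: "bit mat \<Rightarrow> nat \<Rightarrow> nat \<Rightarrow> nat \<Rightarrow> combination list" where
  "level A s p 0 = map (\<lambda>i. (0, [i])) [0..<dim_row A]"
| "level A s p (Suc l) =
     step (block_key A (l * p) (min (dim_col A) (l * p + p))) s ((2 * s) ^ l) (level A s p l)"

text \<open>Appending a bit sends \<open>X + 1\<close> to at most \<open>2 * (X + 1)\<close>; in
  this shifted form the induction closes.\<close>

lemma block_key_less:
  assumes "fst T < W"
  shows "block_key A k k' T < W * 2 ^ (k' - k)"
proof -
  have "foldl (\<lambda>a k. 2 * a + of_bool (coord A T k = 1)) a [k..<k + d] + 1 \<le> (a + 1) * 2 ^ d" for a d :: nat
  proof (induction d)
    case (Suc d)
    define X where "X = foldl (\<lambda>a k. 2 * a + of_bool (coord A T k = 1)) a [k..<k + d]"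
    have "2 * X + of_bool (coord A T (k + d) = 1) + 1 \<le> 2 * (X + 1)" by simp
    also have "\<dots> \<le> 2 * ((a + 1) * 2 ^ d)"
      using Suc unfolding X_def by (rule mult_le_mono2)
    finally show ?case
      unfolding X_def by simp
  qed simp
  note * = this[of "fst T" "k' - k"]
  show ?thesis
  proof (cases "k \<le> k'")
    case True
    have "(fst T + 1) * 2 ^ (k' - k) \<le> W * 2 ^ (k' - k)"
      using assms by (intro mult_le_mono1) simp
    then show ?thesis
      using * True by (simp add: block_key_def)
  qed (use assms in \<open>simp add: block_key_def\<close>)
qed

lemma block_key_eqD:
  assumes "block_key A k k' T = block_key A k k' T'"
  shows "fst T = fst T' \<and> (\<forall>i. k \<le> i \<and> i < k' \<longrightarrow> coord A T i = coord A T' i)"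
proof -
  have *: "foldl (\<lambda>a k. 2 * a + of_bool (f k = 1)) a [k..<k + d] =
      foldl (\<lambda>a k. 2 * a + of_bool (g k = 1)) a' [k..<k + d] \<Longrightarrow>
      a = a' \<and> (\<forall>i. k \<le> i \<and> i < k + d \<longrightarrow> f i = g i)" for f g :: "nat \<Rightarrow> bit" and a a' d :: nat
  proof (induction d)
    case (Suc d)
    define X where "X = foldl (\<lambda>a k. 2 * a + of_bool (f k = 1)) a [k..<k + d]"
    define Y where "Y = foldl (\<lambda>a k. 2 * a + of_bool (g k = 1)) a' [k..<k + d]"
    have "2 * X + of_bool (f (k + d) = 1) = 2 * Y + of_bool (g (k + d) = 1)"
      using Suc.prems by (simp add: X_def Y_def)
    \<comment> \<open>Parity determines the last bit.\<close>
    then have "X = Y \<and> f (k + d) = g (k + d)"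
      by (cases "f (k + d)"; cases "g (k + d)") (simp_all, presburger+)
    then show ?case
      using Suc.IH unfolding X_def Y_def by (auto simp: less_Suc_eq)
  next
    case 0
    then show ?case by (simp, meson not_le)
  qed
  show ?thesis
  proof (cases "k \<le> k'")
    case True
    then show ?thesis
      using *[of "coord A T" "fst T" "k' - k" "coord A T'" "fst T'"] assms by (simp add: block_key_def)
  next
    case False
    then show ?thesis
      using assms by (auto simp: block_key_def)
  qed
qed

lemma length_step: "s > 0 \<Longrightarrow> length (step key s W xs) \<le> s * length xs"
  by (simp add: step_def length_pairs)

lemma length_level: "s > 0 \<Longrightarrow> length (level A s p l) \<le> dim_row A * s ^ l"
proof (induction l)
  case (Suc l)
  then have "length (level A s p (Suc l)) \<le> s * length (level A s p l)"
    by (simp add: length_step)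
  also have "\<dots> \<le> s * (dim_row A * s ^ l)"
    using Suc by simp
  finally show ?case by (simp add: algebra_simps)
qed simp

lemma set_stepE:
  assumes "T \<in> set (step key s W xs)"
  obtains u i where "u < i" "i < length xs" "bucket (\<lambda>i. key (xs ! i)) s u = bucket (\<lambda>i. key (xs ! i)) s i"
    "key (xs ! u) = key (xs ! i)" "T = combine key s W xs (u, i)"
proof -
  obtain u i where "T = combine key s W xs (u, i)" "(u, i) \<in> set (pairs (\<lambda>i. key (xs ! i)) s (length xs))"
    using assms by (auto simp: step_def)
  then show ?thesis
    using that[of u i] by (simp add: in_pairs bucket_def)
qed

lemma digit_bound:
  fixes W x a b s :: nat
  assumes "x < W" "a < s" "b < s"
  shows "x + (W * a + W * b) < 2 * s * W"
proof -
  have "x + (W * a + W * b) < W * (1 + a + b)"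
    using assms(1) by (simp add: algebra_simps)
  also have "\<dots> \<le> W * (2 * s)"
    using assms(2,3) by (intro mult_le_mono2) simp
  finally show ?thesis by (simp add: mult.commute)
qed

lemma fst_level: "s > 0 \<Longrightarrow> T \<in> set (level A s p l) \<Longrightarrow> fst T < (2 * s) ^ l"
proof (induction l arbitrary: T)
  case (Suc l)
  from Suc.prems(2) show ?case unfolding level.simps
  proof (rule set_stepE)
    fix u i assume "i < length (level A s p l)"
      and "T = combine (block_key A (l * p) (min (dim_col A) (l * p + p))) s ((2 * s) ^ l) (level A s p l) (u, i)"
    then show "fst T < (2 * s) ^ Suc l"
      using Suc by (simp add: combine_def digit_bound)
  qed
next
  case 0
  then show ?case by auto
qed

lemma snd_level: "T \<in> set (level A s p l) \<Longrightarrow> set (snd T) \<subseteq> {..<dim_row A}"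
proof (induction l arbitrary: T)
  case (Suc l)
  from Suc.prems show ?case unfolding level.simps
  proof (rule set_stepE)
    fix u i assume "u < i" "i < length (level A s p l)"
      and "T = combine (block_key A (l * p) (min (dim_col A) (l * p + p))) s ((2 * s) ^ l) (level A s p l) (u, i)"
    then show "set (snd T) \<subseteq> {..<dim_row A}"
      using Suc.IH[of "level A s p l ! u"] Suc.IH[of "level A s p l ! i"] by (simp add: combine_def)
  qed
qed auto

lemma coord_combine: "coord A (combine key s W xs (u, i)) k = coord A (xs ! u) k + coord A (xs ! i) k"
  by (simp add: coord_def combine_def)

lemma rhs_combine: "rhs b (combine key s W xs (u, i)) = rhs b (xs ! u) + rhs b (xs ! i)"
  by (simp add: rhs_def combine_def)

text \<open>On earlier blocks both summands already vanish; on the current block they agree by the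
  key and cancel in characteristic 2.\<close>

lemma coord_level:
  "T \<in> set (level A s p l) \<Longrightarrow> k < l * p \<Longrightarrow> k < dim_col A \<Longrightarrow> coord A T k = 0"
proof (induction l arbitrary: T)
  case (Suc l)
  let ?key = "block_key A (l * p) (min (dim_col A) (l * p + p))"
  from Suc.prems(1) show ?case unfolding level.simps
  proof (rule set_stepE)
    fix u i assume ui: "u < i" "i < length (level A s p l)"
      and eq: "?key (level A s p l ! u) = ?key (level A s p l ! i)"
      and T: "T = combine ?key s ((2 * s) ^ l) (level A s p l) (u, i)"
    have "coord A (level A s p l ! u) k = coord A (level A s p l ! i) k"
    proof (cases "k < l * p")
      case True
      then show ?thesis using Suc ui by simp
    next
      case False
      then show ?thesis using block_key_eqD[OF eq] Suc.prems by simp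
    qed
    then show "coord A T k = 0"
      by (simp add: T coord_combine)
  qed
qed simp

text \<open>This is what orthogonality needs: the product of two signs with the same identifier is
  then a nontrivial character of \<open>b\<close> and averages to zero.\<close>

definition separated :: "combination list \<Rightarrow> bool" where
  "separated xs \<longleftrightarrow> (\<forall>i<length xs. snd (xs ! i) \<noteq> [] \<and> distinct (snd (xs ! i))) \<and>
     (\<forall>i<length xs. \<forall>j<length xs. i \<noteq> j \<longrightarrow> fst (xs ! i) = fst (xs ! j) \<longrightarrow>
        set (snd (xs ! i)) \<inter> set (snd (xs ! j)) = {})"

lemma digits_inject:
  fixes W x y d e :: nat
  assumes "x + W * d = y + W * e" "x < W" "y < W"
  shows "x = y \<and> d = e"
proof -
  have "(x + W * d) mod W = x" "(x + W * d) div W = d" "(y + W * e) mod W = y" "(y + W * e) div W = e"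
    using assms(2,3) by simp_all
  then show ?thesis using assms(1) by metis
qed

text \<open>Equal new identifiers force equal old identifiers and equal position sums. If two such
  pairs shared an index, they would lie in one chunk, and the equal sums would put the remaining
  indices at the same position, hence make them equal. The pairs would then coincide or be reversals
  of each other, and \<open>u < i\<close> rules out the latter. So no index is shared and the old
  disjointness applies.\<close>

lemma separated_step:
  assumes sep: "separated xs" and id: "\<And>T. T \<in> set xs \<Longrightarrow> fst T < W"
    and key: "\<And>T T'. key T = key T' \<Longrightarrow> fst T = fst T'" and "s > 0"
  shows "separated (step key s W xs)"
proof -
  let ?k = "\<lambda>i. key (xs ! i)" and ?ps = "pairs (\<lambda>i. key (xs ! i)) s (length xs)"
  have disj: "set (snd (xs ! i)) \<inter> set (snd (xs ! j)) = {}"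
    if "i < length xs" "j < length xs" "i \<noteq> j" "fst (xs ! i) = fst (xs ! j)" for i j
    using sep that unfolding separated_def by blast
  have P: "u < i \<and> i < length xs \<and> bucket ?k s u = bucket ?k s i \<and> fst (xs ! u) = fst (xs ! i)"
    if "(u, i) \<in> set ?ps" for u i
    using that key[of "xs ! u" "xs ! i"] by (auto simp: in_pairs bucket_def)
  have 1: "snd (combine key s W xs q) \<noteq> [] \<and> distinct (snd (combine key s W xs q))" if "q \<in> set ?ps" for q
  proof -
    obtain u i where q: "q = (u, i)" by force
    show ?thesis
      using P[of u i] that sep disj[of u i] unfolding q combine_def separated_def by auto
  qed
  have 2: "set (snd (combine key s W xs q)) \<inter> set (snd (combine key s W xs q')) = {}"
    if q: "q \<in> set ?ps" "q' \<in> set ?ps" "q \<noteq> q'" and eq: "fst (combine key s W xs q) = fst (combine key s W xs q')" for q q'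
  proof -
    obtain u i u' i' where qq: "q = (u, i)" "q' = (u', i')" by force
    note P1 = P[of u i] and P2 = P[of u' i']
    have len: "u < length xs" "i < length xs" "u' < length xs" "i' < length xs"
      using P1 P2 q qq by auto
    have "fst (xs ! i) + W * (class_rank ?k u mod s + class_rank ?k i mod s) =
        fst (xs ! i') + W * (class_rank ?k u' mod s + class_rank ?k i' mod s)"
      using eq by (simp add: qq combine_def algebra_simps)
    moreover have "fst (xs ! i) < W" "fst (xs ! i') < W"
      using id len by simp_all
    ultimately have ids: "fst (xs ! i) = fst (xs ! i')"
      and d: "class_rank ?k u mod s + class_rank ?k i mod s = class_rank ?k u' mod s + class_rank ?k i' mod s"
      using digits_inject by blast+
    have all: "fst (xs ! u) = fst (xs ! i)" "fst (xs ! u') = fst (xs ! i)" "fst (xs ! i') = fst (xs ! i)"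
      using P1 P2 q qq ids by auto
    have bk: "bucket ?k s u = bucket ?k s i" "bucket ?k s u' = bucket ?k s i'" "u < i" "u' < i'"
      using P1 P2 q qq by auto
    have ne1: "u \<noteq> u'"
    proof
      assume e: "u = u'"
      have "i = i'"
        using bk(1,2) d e by - (rule bucket_position_inject[of ?k s], simp_all)
      then show False
        using e q(3) qq by simp
    qed
    have ne2: "u \<noteq> i'"
    proof
      assume e: "u = i'"
      have "i = u'"
        using bk(1,2) d e by - (rule bucket_position_inject[of ?k s], simp_all)
      then show False
        using e bk(3,4) by simp
    qed
    have ne3: "i \<noteq> u'"
    proof
      assume e: "i = u'"
      have "u = i'"
        using bk(1,2) d e by - (rule bucket_position_inject[of ?k s], simp_all)
      then show False
        using e bk(3,4) by simp
    qed
    have ne4: "i \<noteq> i'"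
    proof
      assume e: "i = i'"
      have "u = u'"
        using bk(1,2) d e by - (rule bucket_position_inject[of ?k s], simp_all)
      then show False
        using e q(3) qq by simp
    qed
    show ?thesis
      using disj[of u u'] disj[of u i'] disj[of i u'] disj[of i i'] ne1 ne2 ne3 ne4 len all
      unfolding qq combine_def by auto
  qed
  have 3: "?ps ! a \<noteq> ?ps ! a'" if "a < length ?ps" "a' < length ?ps" "a \<noteq> a'" for a a'
    using that distinct_pairs nth_eq_iff_index_eq by blast
  show ?thesis
    unfolding separated_def step_def using 1 2 3 by simp
qed

lemma separated_level:
  assumes "s > 0"
  shows "separated (level A s p l)"
proof (induction l)
  case 0
  show ?case by (auto simp: separated_def)
next
  case (Suc l)
  show ?case
    unfolding level.simps
    by (rule separated_step) (use Suc fst_level assms block_key_eqD in blast)+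
qed

declare add_bit_eq_xor [simp del] mult_bit_eq_and [simp del] \<comment> \<open>they replace ring operations by \<open>of_bool\<close> terms\<close>

section \<open>Bounding the bias of every assignment\<close>

section \<open>Soundness of the certificate\<close>

text \<open>The bits \<open>f i\<close> are arbitrary here; later \<open>f i\<close> is the residual
  of equation \<open>i\<close> at a vector \<open>x\<close>, so that one argument covers all
  \<open>x\<close>.\<close>

definition chi :: "(nat \<Rightarrow> bit) \<Rightarrow> combination \<Rightarrow> real" where
  "chi f T = sg (\<Sum>i\<leftarrow>snd T. f i)"

definition sign_sum :: "(nat \<Rightarrow> bit) \<Rightarrow> combination list \<Rightarrow> real" where
  "sign_sum f xs = (\<Sum>T\<leftarrow>xs. chi f T)"

lemma chi_combine: "chi f (combine key s W xs (u, i)) = chi f (xs ! u) * chi f (xs ! i)"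
  by (simp add: chi_def combine_def sg_add)

lemma chi_square [simp]: "(chi f T)\<^sup>2 = 1"
  by (simp add: chi_def)

lemma sign_sum_nth: "sign_sum f xs = (\<Sum>i<length xs. chi f (xs ! i))"
  by (simp add: sign_sum_def sum_list_sum_nth atLeast0LessThan)

lemma sign_sum_step:
  "sign_sum f (step key s W xs) = (\<Sum>i<length xs. \<Sum>u<i.
     if bucket (\<lambda>i. key (xs ! i)) s u = bucket (\<lambda>i. key (xs ! i)) s i then chi f (xs ! u) * chi f (xs ! i) else 0)"
proof -
  have "sign_sum f (step key s W xs) =
      (\<Sum>(u, i)\<leftarrow>pairs (\<lambda>i. key (xs ! i)) s (length xs). chi f (xs ! u) * chi f (xs ! i))"
    unfolding sign_sum_def step_def map_map o_def
    by (intro arg_cong[where f = sum_list] map_cong) (auto simp: chi_combine)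
  then show ?thesis
    by (simp add: sum_pairs)
qed

lemma sign_sum_square_le:
  assumes "s > 0" and key: "\<And>T. T \<in> set xs \<Longrightarrow> key T < K"
  shows "(sign_sum f xs)\<^sup>2 * s \<le> (length xs + s * K) * (length xs + 2 * sign_sum f (step key s W xs))"
proof -
  let ?k = "\<lambda>i. key (xs ! i)" and ?N = "length xs"
  let ?B = "card (bucket ?k s ` {..<?N})" and ?Y = "?N + 2 * sign_sum f (step key s W xs)"
  have le: "(sign_sum f xs)\<^sup>2 \<le> ?B * ?Y"
    unfolding sign_sum_step unfolding sign_sum_nth by (rule square_sum_le_buckets) simp
  have "?B * s \<le> ?N + s * card (?k ` {..<?N})"
    by (rule number_of_buckets) (rule assms)
  also have "card (?k ` {..<?N}) \<le> card {..<K}"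
    using key nth_mem by (intro card_mono) blast+
  finally have B: "?B * s \<le> ?N + s * K"
    by (simp add: mult_le_mono2)
  \<comment> \<open>The bound on \<open>?B\<close> can be multiplied by \<open>?Y\<close> only if
    \<open>?Y\<close> is nonnegative. Cauchy-Schwarz itself shows this unless there are no
    buckets.\<close>
  have Y: "?Y \<ge> 0"
  proof (cases "?B = 0")
    case True
    then have "xs = []" by (simp add: card_eq_0_iff lessThan_empty_iff)
    then show ?thesis by (simp add: step_def sign_sum_def)
  next
    case False
    have "0 \<le> real ?B * ?Y"
      using le by (rule order_trans[OF zero_le_power2])
    with False show ?thesis
      by (auto simp only: zero_le_mult_iff of_nat_0_less_iff of_nat_le_0_iff neq0_conv)
  qed
  have "(sign_sum f xs)\<^sup>2 * s \<le> ?B * ?Y * s"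
    by (intro mult_right_mono le) simp
  also have "\<dots> = real (?B * s) * ?Y" by simp
  also have "\<dots> \<le> real (?N + s * K) * ?Y"
    by (intro mult_right_mono Y) (use B in linarith)
  finally show ?thesis by simp
qed

text \<open>
  Passing to the next level squares the bias up to constant factors, whence the exponents \<open>2 ^ l\<close>; the
  constant \<open>5\<close> makes the induction work because \<open>2 + 4 * 5 \<le> 5\<^sup>2\<close>.
\<close>

lemma sign_sum_level_le:
  fixes \<tau> :: real
  assumes m: "m = dim_row A" and s: "s = 2 ^ (2 ^ L * 2 ^ L)" and \<tau>: "\<tau> = 1 / 2 ^ 2 ^ L"
    and size: "s * 2 ^ L * 2 ^ p \<le> m"
    and top: "sign_sum f (level A s p L) * s \<le> m * s ^ L"
    and "l \<le> L"
  shows "sign_sum f (level A s p l) \<le> 5 * \<tau> ^ 2 ^ l * (m * s ^ l)"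
  using \<open>l \<le> L\<close>
proof (induction rule: inc_induct)
  case base
  \<comment> \<open>By the choice of \<open>s\<close>, the threshold tested at the top is exactly
    the bias \<open>\<tau> ^ 2 ^ L\<close>.\<close>
  have st: "\<tau> ^ 2 ^ L = 1 / s"
    by (simp add: \<tau> s power_one_over power_mult)
  have "s > 0" by (simp add: s)
  then have "sign_sum f (level A s p L) \<le> \<tau> ^ 2 ^ L * (m * s ^ L)"
    using top by (simp add: st field_simps)
  also have "\<dots> \<le> 5 * \<tau> ^ 2 ^ L * (m * s ^ L)"
    using \<tau> by (intro mult_right_mono) auto
  finally show ?case .
next
  case (step l)
  define key where "key = block_key A (l * p) (min (dim_col A) (l * p + p))"
  define xs where "xs = level A s p l"
  define M where "M = m * s ^ l"
  have "s > 0" by (simp add: s)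
  have \<tau>01: "0 < \<tau>" "\<tau> \<le> 1" by (simp_all add: \<tau>)
  have st: "\<tau> ^ 2 ^ L = 1 / s"
    by (simp add: \<tau> s power_one_over power_mult)
  have key: "key T < (2 * s) ^ l * 2 ^ p" if "T \<in> set xs" for T
  proof -
    have "key T < (2 * s) ^ l * 2 ^ (min (dim_col A) (l * p + p) - l * p)"
      unfolding key_def by (rule block_key_less) (use fst_level[OF \<open>s > 0\<close>] that xs_def in simp)
    also have "\<dots> \<le> (2 * s) ^ l * 2 ^ p"
      by (intro mult_le_mono2 power_increasing) auto
    finally show ?thesis .
  qed
  have len: "length xs \<le> M"
    using length_level[OF \<open>s > 0\<close>, of A p l] by (simp add: xs_def M_def m)
  \<comment> \<open>The size condition makes the rounding loss of the chunks at most
    \<open>M\<close>, so the number of chunks times \<open>s\<close> is at most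
    \<open>2 * M\<close>.\<close>
  have "s * ((2 * s) ^ l * 2 ^ p) = s * 2 ^ l * 2 ^ p * s ^ l"
    by (simp add: power_mult_distrib)
  also have "\<dots> \<le> s * 2 ^ L * 2 ^ p * s ^ l"
    using step.hyps by (intro mult_le_mono1 mult_le_mono2 power_increasing) auto
  also have "\<dots> \<le> M"
    unfolding M_def by (intro mult_le_mono1 size)
  finally have K: "s * ((2 * s) ^ l * 2 ^ p) \<le> M" .
  define Y where "Y = length xs + 2 * sign_sum f (step key s ((2 * s) ^ l) xs)"
  have sq: "(sign_sum f xs)\<^sup>2 * s \<le> real (length xs + s * ((2 * s) ^ l * 2 ^ p)) * Y"
    using sign_sum_square_le[OF \<open>s > 0\<close> key, where f = f and W = "(2 * s) ^ l"] unfolding Y_def by simp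
  have "1 / s \<le> \<tau> ^ 2 ^ Suc l"
    unfolding st[symmetric] using step.hyps \<tau>01 by (intro power_decreasing power_increasing) auto
  then have "real M \<le> M * (s * \<tau> ^ 2 ^ Suc l)"
    using \<open>s > 0\<close> mult_left_mono[of 1 "s * \<tau> ^ 2 ^ Suc l" "real M"] by (simp add: field_simps)
  moreover have "sign_sum f (step key s ((2 * s) ^ l) xs) \<le> 5 * \<tau> ^ 2 ^ Suc l * (M * s)"
    using step.IH by (simp add: key_def xs_def M_def algebra_simps)
  \<comment> \<open>Here \<open>11 = 1 + 2 * 5\<close>: the diagonal is absorbed because
    \<open>1 / s \<le> \<tau> ^ 2 ^ Suc l\<close>.\<close>
  ultimately have Y: "Y \<le> 11 * \<tau> ^ 2 ^ Suc l * (M * s)"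
    using len unfolding Y_def by (simp add: algebra_simps)
  have "(sign_sum f xs)\<^sup>2 * s \<le> real (2 * M) * (11 * \<tau> ^ 2 ^ Suc l * (M * s))"
  \<comment> \<open>Monotonicity of the product needs \<open>Y\<close> nonnegative; otherwise the
    left-hand side is already at most 0.\<close>
  proof (cases "Y \<ge> 0")
    case True
    have "real (length xs + s * ((2 * s) ^ l * 2 ^ p)) \<le> real (2 * M)"
      using len K by (simp only: of_nat_le_iff)
    then show ?thesis
      using sq True Y by (meson mult_mono order_trans of_nat_0_le_iff)
  next
    case False
    then have "(sign_sum f xs)\<^sup>2 * s \<le> 0"
      using sq by (meson mult_nonneg_nonpos of_nat_0_le_iff order_trans linear)
    also have "0 \<le> real (2 * M) * (11 * \<tau> ^ 2 ^ Suc l * (M * s))"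
      using \<tau>01 by simp
    finally show ?thesis .
  qed
  then have "(sign_sum f xs)\<^sup>2 \<le> 22 * \<tau> ^ 2 ^ Suc l * M\<^sup>2"
    using \<open>s > 0\<close> by (simp add: power2_eq_square algebra_simps)
  also have "\<dots> \<le> 25 * \<tau> ^ 2 ^ Suc l * M\<^sup>2"
    using \<tau>01 by (intro mult_right_mono) auto
  also have "\<dots> = (5 * \<tau> ^ 2 ^ l * M)\<^sup>2"
    by (simp add: power_mult_distrib power_mult[symmetric] mult.commute)
  finally have "sign_sum f xs \<le> 5 * \<tau> ^ 2 ^ l * M"
    by (rule power2_le_imp_le) (use \<tau>01 in simp)
  then show ?case
    by (simp add: xs_def M_def)
qed

lemma sum_list_coord:
  fixes x :: "bit vec"
  assumes "A \<in> carrier_mat m n" "x \<in> carrier_vec n" "set S \<subseteq> {..<m}"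
  shows "(\<Sum>i\<leftarrow>S. scalar_prod (row A i) x + vec_index b i) =
    (\<Sum>k<n. coord A (t, S) k * vec_index x k) + rhs b (t, S)"
  using assms(3)
proof (induction S)
  case (Cons i S)
  have "scalar_prod (row A i) x = (\<Sum>k<n. A $$ (i, k) * vec_index x k)"
    using assms Cons.prems by (auto simp: scalar_prod_def atLeast0LessThan intro!: sum.cong)
  then show ?case
    using Cons by (simp add: coord_def rhs_def sum.distrib algebra_simps)
qed (simp add: coord_def rhs_def)

text \<open>Since \<open>n \<le> L * p\<close>, every column has been eliminated and
  \<open>x\<close> drops out. This is why a single number certifies all \<open>x\<close> at
  once.\<close>

lemma sign_sum_last_level:
  fixes x :: "bit vec"
  assumes A: "A \<in> carrier_mat m n" and x: "x \<in> carrier_vec n" and "n \<le> L * p"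
  shows "sign_sum (\<lambda>i. scalar_prod (row A i) x + vec_index b i) (level A s p L) =
    (\<Sum>T\<leftarrow>level A s p L. sg (rhs b T))"
  unfolding sign_sum_def
proof (intro arg_cong[where f = sum_list] map_cong refl)
  fix T assume T: "T \<in> set (level A s p L)"
  have "coord A T k = 0" if "k < n" for k
    using coord_level[OF T, of k] that assms by auto
  then show "chi (\<lambda>i. scalar_prod (row A i) x + vec_index b i) T = sg (rhs b T)"
    using sum_list_coord[OF A x, of "snd T" b "fst T"] snd_level[OF T] A by (simp add: chi_def)
qed

text \<open>Finiteness gives meaning to \<open>Max\<close> in \<open>val\<close> and to the uniform
  distribution of right-hand sides.\<close>

lemma finite_carrier_vec_bit: "finite (carrier_vec n :: bit vec set)"
proof -
  have "(UNIV :: bit set) = {0, 1}" by auto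
  then have "finite (UNIV :: bit set)" by (metis finite.emptyI finite.insertI)
  then have "finite {xs :: bit list. set xs \<subseteq> UNIV \<and> length xs = n}"
    by (rule finite_lists_length_eq)
  then have "finite (vec_of_list ` {xs :: bit list. set xs \<subseteq> UNIV \<and> length xs = n})"
    by (rule finite_imageI)
  moreover have "v \<in> vec_of_list ` {xs. set xs \<subseteq> UNIV \<and> length xs = n}"
    if "v \<in> carrier_vec n" for v :: "bit vec"
    using that by (intro image_eqI[of _ _ "list_of_vec v"]) (auto simp: vec_list)
  ultimately show ?thesis
    by (blast intro: finite_subset)
qed

text \<open>The sum of signs is twice the number of satisfied equations minus
  \<open>m\<close>.\<close>

lemma val_le:
  fixes b :: "bit vec"
  assumes A: "A \<in> carrier_mat m n" and "m > 0"
    and le: "\<And>x. x \<in> carrier_vec n \<Longrightarrow>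
      (\<Sum>i<m. sg (scalar_prod (row A i) x + vec_index b i)) \<le> 2 * \<epsilon> * m"
  shows "val A b \<le> 1 / 2 + \<epsilon>"
proof -
  have "real (card {i. i < m \<and> scalar_prod (row A i) x = vec_index b i}) / m \<le> 1 / 2 + \<epsilon>"
    if "x \<in> carrier_vec n" for x
  proof -
    let ?S = "{i. i < m \<and> scalar_prod (row A i) x = vec_index b i}"
    have sg: "sg (a + c) = 2 * of_bool (a = c) - 1" for a c
      by (cases a; cases c) (simp_all add: sg_def)
    have "(\<Sum>i<m. sg (scalar_prod (row A i) x + vec_index b i)) =
        2 * (\<Sum>i<m. of_bool (scalar_prod (row A i) x = vec_index b i)) - real m"
      by (simp only: sg sum_subtractf sum_distrib_left) simp
    also have "(\<Sum>i<m. of_bool (scalar_prod (row A i) x = vec_index b i)) = real (card ?S)"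
      by (simp add: sum_of_bool_eq Int_def lessThan_def)
    finally have "2 * real (card ?S) \<le> (1 + 2 * \<epsilon>) * m"
      using le[OF that] by (simp add: algebra_simps)
    then show ?thesis
      using \<open>m > 0\<close> by (simp add: field_simps)
  qed
  moreover have ne: "(carrier_vec n :: bit vec set) \<noteq> {}"
    using zero_carrier_vec by blast
  ultimately show ?thesis
    using A finite_carrier_vec_bit[of n] unfolding val_def by (subst Max_le_iff) auto
qed

text \<open>Level 0 is the input system, where the bias bound is \<open>5 * \<tau>\<close>; half of
  it is the excess over \<open>1 / 2\<close>. The premise \<open>top\<close> mentions
  \<open>b\<close> but no \<open>x\<close>, so it can be tested.\<close>

theorem certificate:
  fixes b :: "bit vec"
  assumes A: "A \<in> carrier_mat m n" and s: "s = 2 ^ (2 ^ L * 2 ^ L)"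
    and size: "s * 2 ^ L * 2 ^ p \<le> m" and np: "n \<le> L * p"
    and top: "(\<Sum>T\<leftarrow>level A s p L. sg (rhs b T)) * s \<le> m * s ^ L"
  shows "val A b \<le> 1 / 2 + 5 / 2 * (1 / 2 ^ 2 ^ L)"
proof (rule val_le[OF A])
  show "m > 0"
    using size by (cases m) (auto simp: s)
next
  fix x :: "bit vec" assume x: "x \<in> carrier_vec n"
  let ?f = "\<lambda>i. scalar_prod (row A i) x + vec_index b i"
  have m: "m = dim_row A" using A by simp
  have "sign_sum ?f (level A s p 0) \<le> 5 * (1 / 2 ^ 2 ^ L) ^ 2 ^ 0 * (m * s ^ 0)"
    by (rule sign_sum_level_le[OF m s refl size])
      (use top sign_sum_last_level[OF A x np] in simp_all)
  moreover have "sign_sum ?f (level A s p 0) = (\<Sum>i<m. sg (?f i))"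
    by (simp add: sign_sum_nth m chi_def)
  ultimately show "(\<Sum>i<m. sg (?f i)) \<le> 2 * (5 / 2 * (1 / 2 ^ 2 ^ L)) * m"
    by simp
qed

section \<open>Second moment of the tested sum for uniform \<open>b\<close>\<close>

section \<open>The certificate of a random right-hand side\<close>

lemma rhs_flip:
  assumes "distinct (snd T)" "b \<in> carrier_vec m" "set (snd T) \<subseteq> {..<m}" "i < m"
  shows "rhs (b + unit_vec m i) T = rhs b T + of_bool (i \<in> set (snd T))"
proof -
  have "distinct S \<Longrightarrow> set S \<subseteq> {..<m} \<Longrightarrow>
      (\<Sum>j\<leftarrow>S. vec_index (b + unit_vec m i) j) = (\<Sum>j\<leftarrow>S. vec_index b j) + of_bool (i \<in> set S)" for S
    using assms(2,4) by (induction S) (auto simp: unit_vec_def)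
  then show ?thesis
    using assms by (simp add: rhs_def)
qed

text \<open>Flipping \<open>b\<close> at an equation of \<open>T\<close> outside \<open>T'\<close>
  is an involution that negates the summand.\<close>

lemma sum_sg_rhs_orthogonal:
  assumes "distinct (snd T)" "distinct (snd T')" "snd T \<noteq> []" "set (snd T) \<inter> set (snd T') = {}"
    "set (snd T) \<subseteq> {..<m}" "set (snd T') \<subseteq> {..<m}"
  shows "(\<Sum>b\<in>carrier_vec m. sg (rhs b T) * sg (rhs b T')) = 0"
proof -
  obtain i where i: "i \<in> set (snd T)" using assms(3) by (cases "snd T") auto
  then have im: "i < m" "i \<notin> set (snd T')" using assms by auto
  let ?g = "\<lambda>b. b + unit_vec m i :: bit vec"
  have inv: "?g (?g b) = b" if "b \<in> carrier_vec m" for b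
    using that by (intro eq_vecI) auto
  have "(\<Sum>b\<in>carrier_vec m. sg (rhs b T) * sg (rhs b T')) =
      (\<Sum>b\<in>carrier_vec m. - (sg (rhs b T) * sg (rhs b T')))"
  proof (rule sum.reindex_bij_witness[where i = ?g and j = ?g])
    fix b :: "bit vec" assume b: "b \<in> carrier_vec m"
    show "- (sg (rhs (?g b) T) * sg (rhs (?g b) T')) = sg (rhs b T) * sg (rhs b T')"
      using rhs_flip[OF assms(1) b assms(5) im(1)] rhs_flip[OF assms(2) b assms(6) im(1)] i im
      by (simp add: sg_add) (simp add: sg_def)
  qed (use inv in auto)
  then show ?thesis
    by (simp add: sum_negf)
qed

text \<open>Cauchy-Schwarz over the at most \<open>D\<close> identifiers; mixed terms within one
  identifier average to zero by \<open>separated\<close>, so only the diagonal remains.\<close>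

lemma second_moment:
  fixes D :: nat
  assumes sep: "separated xs" and id: "\<And>T. T \<in> set xs \<Longrightarrow> fst T < D"
    and S: "\<And>T. T \<in> set xs \<Longrightarrow> set (snd T) \<subseteq> {..<m}"
  shows "(\<Sum>b\<in>carrier_vec m. (\<Sum>T\<leftarrow>xs. sg (rhs b T))\<^sup>2) \<le>
    card (carrier_vec m :: bit vec set) * (D * real (length xs))"
proof -
  let ?N = "length xs" and ?C = "carrier_vec m :: bit vec set"
  let ?id = "\<lambda>i. fst (xs ! i)"
  let ?c = "\<lambda>b. \<Sum>i<?N. \<Sum>u<i. if ?id u = ?id i then sg (rhs b (xs ! u)) * sg (rhs b (xs ! i)) else 0"
  have "card (?id ` {..<?N}) \<le> card {..<D}"
    using id nth_mem by (intro card_mono) blast+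
  then have D: "card (?id ` {..<?N}) \<le> D" by simp
  have "(\<Sum>b\<in>?C. (\<Sum>T\<leftarrow>xs. sg (rhs b T))\<^sup>2) \<le> (\<Sum>b\<in>?C. card (?id ` {..<?N}) * (?N + 2 * ?c b))"
  proof (rule sum_mono)
    fix b :: "bit vec"
    show "(\<Sum>T\<leftarrow>xs. sg (rhs b T))\<^sup>2 \<le> card (?id ` {..<?N}) * (?N + 2 * ?c b)"
      using square_sum_le_buckets[of ?N "\<lambda>i. sg (rhs b (xs ! i))" ?id]
      by (simp add: sum_list_sum_nth atLeast0LessThan)
  qed
  also have "\<dots> = card (?id ` {..<?N}) * (card ?C * real ?N + 2 * (\<Sum>b\<in>?C. ?c b))"
    by (simp add: sum_distrib_left[symmetric] sum.distrib)
  also have "(\<Sum>b\<in>?C. ?c b) = (\<Sum>i<?N. \<Sum>u<i. \<Sum>b\<in>?C.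
      if ?id u = ?id i then sg (rhs b (xs ! u)) * sg (rhs b (xs ! i)) else 0)"
    by (subst sum.swap) (intro sum.cong refl sum.swap)
  also have "\<dots> = 0"
  proof (rule sum.neutral, rule ballI, rule sum.neutral, rule ballI)
    fix i u assume iu: "i \<in> {..<?N}" "u \<in> {..<i}"
    show "(\<Sum>b\<in>?C. if ?id u = ?id i then sg (rhs b (xs ! u)) * sg (rhs b (xs ! i)) else 0) = 0"
    proof (cases "?id u = ?id i")
      case True
      have "(\<Sum>b\<in>?C. sg (rhs b (xs ! u)) * sg (rhs b (xs ! i))) = 0"
        by (rule sum_sg_rhs_orthogonal) (use sep iu True S in \<open>auto simp: separated_def\<close>)
      then show ?thesis using True by simp
    qed simp
  qed
  also have "card (?id ` {..<?N}) * (card ?C * real ?N + 2 * 0) \<le> D * (card ?C * real ?N)"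
    using D by (simp add: mult_right_mono)
  finally show ?thesis by (simp add: algebra_simps)
qed

text \<open>Chebyshev's inequality in counting form. With at most \<open>(2 * s) ^ L\<close>
  identifiers and \<open>m * s ^ L\<close> combinations, division by the squared threshold leaves
  \<open>2 ^ L * s ^ 2 / m\<close>.\<close>

lemma card_failures:
  assumes A: "A \<in> carrier_mat m n" and "s > 0" "m > 0"
  shows "card {b \<in> carrier_vec m. \<not> (\<Sum>T\<leftarrow>level A s p L. sg (rhs b T)) * s \<le> m * s ^ L} * real m \<le>
    card (carrier_vec m :: bit vec set) * (2 ^ L * real s ^ 2)"
proof -
  let ?C = "carrier_vec m :: bit vec set" and ?xs = "level A s p L"
  let ?F = "\<lambda>b. \<Sum>T\<leftarrow>?xs. sg (rhs b T)"
  let ?B = "{b \<in> ?C. \<not> ?F b * s \<le> m * s ^ L}"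
  have "card ?B * (m * real s ^ L)\<^sup>2 = (\<Sum>b\<in>?B. (m * real s ^ L)\<^sup>2)"
    by simp
  also have "\<dots> \<le> (\<Sum>b\<in>?B. (?F b * s)\<^sup>2)"
    by (intro sum_mono power_mono) auto
  also have "\<dots> \<le> (\<Sum>b\<in>?C. (?F b * s)\<^sup>2)"
    by (intro sum_mono2 finite_carrier_vec_bit) auto
  also have "\<dots> = (\<Sum>b\<in>?C. (?F b)\<^sup>2) * real s ^ 2"
    by (simp add: power_mult_distrib sum_distrib_right)
  also have "\<dots> \<le> card ?C * (real ((2 * s) ^ L) * real (length ?xs)) * real s ^ 2"
    by (intro mult_right_mono second_moment separated_level fst_level assms)
      (use snd_level[of _ A] A in \<open>simp_all only: carrier_matD zero_le_power of_nat_0_le_iff\<close>)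
  also have "\<dots> \<le> card ?C * (real ((2 * s) ^ L) * real (m * s ^ L)) * real s ^ 2"
    using length_level[OF \<open>s > 0\<close>, of A p L] A
    by (intro mult_right_mono mult_left_mono) (auto simp only: of_nat_le_iff carrier_matD zero_le_power of_nat_0_le_iff)
  also have "\<dots> = card ?C * (2 ^ L * real s ^ 2) * (m * (real s ^ L)\<^sup>2)"
    by (simp add: power_mult_distrib power2_eq_square)
  finally have "(card ?B * real m) * (m * (real s ^ L)\<^sup>2) \<le> card ?C * (2 ^ L * real s ^ 2) * (m * (real s ^ L)\<^sup>2)"
    by (simp add: power_mult_distrib power2_eq_square algebra_simps)
  then show ?thesis
    using assms by (simp add: mult_le_cancel_right)
qed

section \<open>Weakest preconditions with running time\<close>

section \<open>Reasoning about programs\<close>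

text \<open>Total correctness with time. As \<open>exec\<close> is deterministic, the existential
  speaks of the only halting run.\<close>

definition run :: "com \<Rightarrow> config \<Rightarrow> (nat \<Rightarrow> config \<Rightarrow> bool) \<Rightarrow> bool" where
  "run p c Q \<longleftrightarrow> (\<exists>t c'. exec p c t c' \<and> Q t c')"

fun written_regs :: "com \<Rightarrow> string set" where
  "written_regs (Assign x e) = {x}"
| "written_regs (Flip x) = {x}"
| "written_regs (Seq p q) = written_regs p \<union> written_regs q"
| "written_regs (Cond b p q) = written_regs p \<union> written_regs q"
| "written_regs (While b p) = written_regs p"
| "written_regs _ = {}"

fun written_arrs :: "com \<Rightarrow> string set" where
  "written_arrs (Write a e e') = {a}"
| "written_arrs (Seq p q) = written_arrs p \<union> written_arrs q"
| "written_arrs (Cond b p q) = written_arrs p \<union> written_arrs q"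
| "written_arrs (While b p) = written_arrs p"
| "written_arrs _ = {}"

definition frame :: "com \<Rightarrow> config \<Rightarrow> config \<Rightarrow> bool" where
  "frame p c c' \<longleftrightarrow> (\<forall>x. x \<notin> written_regs p \<longrightarrow> regs c' x = regs c x) \<and>
     (\<forall>a. a \<notin> written_arrs p \<longrightarrow> arrs c' a = arrs c a)"

lemma frame_regs: "frame p c c' \<Longrightarrow> x \<notin> written_regs p \<Longrightarrow> regs c' x = regs c x"
  and frame_arrs: "frame p c c' \<Longrightarrow> a \<notin> written_arrs p \<Longrightarrow> arrs c' a = arrs c a"
  by (simp_all add: frame_def)

lemma exec_frame: "exec p c t c' \<Longrightarrow> frame p c c'"
  by (induction rule: exec.induct) (auto simp: frame_def)

lemma run_frame: "run p c Q \<Longrightarrow> (\<And>t c'. Q t c' \<Longrightarrow> frame p c c' \<Longrightarrow> Q' t c') \<Longrightarrow> run p c Q'"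
  unfolding run_def using exec_frame by blast

lemma run_Skip [simp]: "run Skip c Q \<longleftrightarrow> Q 1 c"
  unfolding run_def by (metis exec.Skip SkipE)

lemma run_Assign [simp]: "run (Assign x e) c Q \<longleftrightarrow>
    Q (1 + acost e) (Config ((regs c)(x := aval e c)) (arrs c) (coins c))"
  unfolding run_def by (metis exec.Assign AssignE)

lemma run_Write [simp]: "run (Write a e e') c Q \<longleftrightarrow>
    Q (1 + acost e + acost e') (Config (regs c) ((arrs c)(a := (arrs c a)(aval e c := aval e' c))) (coins c))"
  unfolding run_def by (metis exec.Write WriteE)

lemma run_Seq [simp]: "run (Seq p q) c Q \<longleftrightarrow> run p c (\<lambda>t c'. run q c' (\<lambda>t'. Q (t + t')))"
  unfolding run_def by (blast intro: exec.Seq elim: SeqE)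

lemma run_Cond [simp]: "run (Cond b p q) c Q \<longleftrightarrow>
    (if bval b c then run p c (\<lambda>t. Q (bcost b + t)) else run q c (\<lambda>t. Q (bcost b + t)))"
  unfolding run_def by (cases "bval b c") (simp_all, (metis exec.CondTrue exec.CondFalse CondE)+)

lemma run_WhileFalse: "\<not> bval b c \<Longrightarrow> Q (bcost b) c \<Longrightarrow> run (While b p) c Q"
  unfolding run_def by (blast intro: exec.WhileFalse)

lemma run_WhileTrue:
  "bval b c \<Longrightarrow> run p c (\<lambda>t c'. run (While b p) c' (\<lambda>t'. Q (bcost b + t + t'))) \<Longrightarrow> run (While b p) c Q"
  unfolding run_def by (blast intro: exec.WhileTrue)

lemma frame_refl: "frame p c c"
  by (simp add: frame_def)

lemma frame_trans: "frame p c c' \<Longrightarrow> frame p c' c'' \<Longrightarrow> frame p c c''"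
  by (simp add: frame_def)

text \<open>The loop runs exactly \<open>N\<close> times. The strict bound \<open>N < Z\<close> pays
  for the last test, so that one number \<open>Z\<close> serves all loops and the time bounds are
  monomials in \<open>Z\<close>.\<close>

lemma run_While:
  assumes init: "I 0 c"
    and step: "\<And>i c'. i < N \<Longrightarrow> I i c' \<Longrightarrow> frame p c c' \<Longrightarrow>
      bval b c' \<and> run p c' (\<lambda>t c''. t \<le> \<tau> \<and> I (Suc i) c'')"
    and exit: "\<And>c'. I N c' \<Longrightarrow> frame p c c' \<Longrightarrow> \<not> bval b c'"
    and "N < Z"
    and post: "\<And>t c'. I N c' \<Longrightarrow> frame p c c' \<Longrightarrow> t \<le> (bcost b + \<tau>) * Z \<Longrightarrow> Q t c'"
  shows "run (While b p) c Q"
proof -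
  \<comment> \<open>Induction on the number \<open>k\<close> of remaining iterations.\<close>
  have "run (While b p) c' (\<lambda>t c''. t \<le> bcost b + k * (bcost b + \<tau>) \<and> I N c'' \<and> frame p c c'')"
    if "k \<le> N" "I (N - k) c'" "frame p c c'" for k c'
    using that
  proof (induction k arbitrary: c')
    case 0
    then show ?case
      using exit by (intro run_WhileFalse) auto
  next
    case (Suc k)
    have i: "N - Suc k < N" "Suc (N - Suc k) = N - k"
      using Suc.prems by auto
    have *: "bval b c' \<and> run p c' (\<lambda>t c''. t \<le> \<tau> \<and> I (N - k) c'')"
      using step[OF i(1) Suc.prems(2,3)] i(2) by simp
    show ?case
    proof (rule run_WhileTrue)
      show "bval b c'" using * by simp
      show "run p c' (\<lambda>t c''. run (While b p) c'' (\<lambda>t' c'''.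
          bcost b + t + t' \<le> bcost b + Suc k * (bcost b + \<tau>) \<and> I N c''' \<and> frame p c c'''))"
      proof (rule run_frame)
        show "run p c' (\<lambda>t c''. t \<le> \<tau> \<and> I (N - k) c'')" using * by simp
      next
        fix t c'' assume a: "t \<le> \<tau> \<and> I (N - k) c''" "frame p c' c''"
        have "run (While b p) c'' (\<lambda>t c''. t \<le> bcost b + k * (bcost b + \<tau>) \<and> I N c'' \<and> frame p c c'')"
          by (rule Suc.IH) (use Suc.prems a frame_trans in auto)
        then show "run (While b p) c'' (\<lambda>t' c'''.
          bcost b + t + t' \<le> bcost b + Suc k * (bcost b + \<tau>) \<and> I N c''' \<and> frame p c c''')"
          by (rule run_frame) (use a in auto)
      qed
    qed
  qed
  from this[of N c] have "run (While b p) c (\<lambda>t c''. t \<le> bcost b + N * (bcost b + \<tau>) \<and> I N c'' \<and> frame p c c'')"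
    using init by (simp add: frame_refl)
  then show ?thesis
  proof (rule run_frame)
    fix t c' assume a: "t \<le> bcost b + N * (bcost b + \<tau>) \<and> I N c' \<and> frame p c c'"
    have "bcost b + N * (bcost b + \<tau>) \<le> Suc N * (bcost b + \<tau>)" by simp
    also have "\<dots> \<le> Z * (bcost b + \<tau>)"
      using \<open>N < Z\<close> by (intro mult_le_mono1) simp
    finally show "Q t c'"
      using a by (intro post) (auto simp: mult.commute)
  qed
qed

section \<open>The elimination with additions and truncated subtractions only\<close>

section \<open>The program\<close>

notation Seq (infixr ";;" 60)

abbreviation "inc x \<equiv> Assign x (Plus (Reg x) (Const 1))"
abbreviation "double x \<equiv> Assign x (Plus (Reg x) (Reg x))"
text \<open>On the values 0 and 1 this is addition in the two-element field.\<close>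

abbreviation "absdiff e e' \<equiv> Plus (Minus e e') (Minus e' e)"

text \<open>
  The combination with number \<open>t\<close> occupies the cells \<open>t * n, \<dots>, t * n + n - 1\<close> of \<open>A\<close> and the cell
  \<open>t\<close> of \<open>b\<close> and \<open>id\<close>; the input is level \<open>0\<close>, and the combinations of the next level are appended.
  The registers \<open>lo\<close> and \<open>hi\<close> delimit the current level, \<open>h\<close> is the number of the next free
  combination, and \<open>qlo, q, r, E\<close> are the products of \<open>lo, t, u, h\<close> with \<open>n\<close>. Positions within a chunk
  are stored in \<open>d\<close> premultiplied by \<open>V = (2 s) ^ l\<close>, so that labels are appended to identifiers without
  a multiplication.
\<close>

definition key_loop :: com where
  "key_loop = While (Conj (Less (Reg ''k'') (Plus (Reg ''pos'') (Reg ''p''))) (Less (Reg ''k'') (Reg ''n'')))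
     (Assign ''y'' (Plus (Plus (Reg ''y'') (Reg ''y'')) (Read ''A'' (Plus (Reg ''q'') (Reg ''k'')))) ;;
      inc ''k'')"

text \<open>A counter that wraps at \<open>s\<close> yields the remainder of the rank in
  \<open>c\<close> and the quotient in \<open>g\<close> without a division; \<open>d\<close> follows
  as \<open>V\<close> times \<open>c\<close>.\<close>

definition rank_loop :: com where
  "rank_loop = While (Less (Reg ''u'') (Reg ''t''))
     (Cond (Equal (Read ''key'' (Reg ''u'')) (Reg ''y''))
        (inc ''c'' ;; Assign ''d'' (Plus (Reg ''d'') (Reg ''V'')) ;;
         Cond (Equal (Reg ''c'') (Reg ''s''))
           (Assign ''c'' (Const 0) ;; Assign ''d'' (Const 0) ;; inc ''g'')
           Skip)
        Skip ;;
      inc ''u'')"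

definition add_loop :: com where
  "add_loop = While (Less (Reg ''k'') (Reg ''n''))
     (Write ''A'' (Plus (Reg ''E'') (Reg ''k''))
        (absdiff (Read ''A'' (Plus (Reg ''r'') (Reg ''k''))) (Read ''A'' (Plus (Reg ''q'') (Reg ''k'')))) ;;
      inc ''k'')"

text \<open>Equal entries of \<open>key\<close> and \<open>g\<close> amount to equal buckets. Only
  earlier combinations are scanned, whose entries previous rounds of \<open>term_loop\<close> have
  stored, so one pass suffices.\<close>

definition emit_loop :: com where
  "emit_loop = While (Less (Reg ''u'') (Reg ''t''))
     (Cond (Conj (Equal (Read ''key'' (Reg ''u'')) (Reg ''y'')) (Equal (Read ''g'' (Reg ''u'')) (Reg ''g'')))
        (Write ''id'' (Reg ''h'') (Plus (Read ''id'' (Reg ''t'')) (Plus (Read ''d'' (Reg ''u'')) (Reg ''d''))) ;;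
         Write ''b'' (Reg ''h'') (absdiff (Read ''b'' (Reg ''u'')) (Read ''b'' (Reg ''t''))) ;;
         Assign ''k'' (Const 0) ;;
         add_loop ;;
         Assign ''E'' (Plus (Reg ''E'') (Reg ''n'')) ;;
         inc ''h'')
        Skip ;;
      inc ''u'' ;;
      Assign ''r'' (Plus (Reg ''r'') (Reg ''n'')))"

definition term_loop :: com where
  "term_loop = While (Less (Reg ''t'') (Reg ''hi''))
     (Assign ''y'' (Read ''id'' (Reg ''t'')) ;; Assign ''k'' (Reg ''pos'') ;;
      key_loop ;;
      Write ''key'' (Reg ''t'') (Reg ''y'') ;;
      Assign ''c'' (Const 0) ;; Assign ''d'' (Const 0) ;; Assign ''g'' (Const 0) ;; Assign ''u'' (Reg ''lo'') ;;
      rank_loop ;;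
      Write ''d'' (Reg ''t'') (Reg ''d'') ;; Write ''g'' (Reg ''t'') (Reg ''g'') ;;
      Assign ''u'' (Reg ''lo'') ;; Assign ''r'' (Reg ''qlo'') ;;
      emit_loop ;;
      inc ''t'' ;; Assign ''q'' (Plus (Reg ''q'') (Reg ''n'')))"

text \<open>\<open>W\<close> doublings multiply by \<open>s = 2 ^ W\<close>. With the extra doubling
  in \<open>level_loop\<close>, \<open>V\<close> becomes \<open>(2 * s) ^ l\<close>, while
  \<open>M\<close> becomes \<open>m * s ^ l\<close>.\<close>

definition scale_loop :: com where
  "scale_loop = While (Less (Reg ''k'') (Reg ''W'')) (double ''V'' ;; double ''M'' ;; inc ''k'')"

definition level_loop :: com where
  "level_loop = While (Less (Reg ''l'') (Reg ''L''))
     (Assign ''t'' (Reg ''lo'') ;; Assign ''q'' (Reg ''qlo'') ;;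
      term_loop ;;
      Assign ''lo'' (Reg ''hi'') ;; Assign ''qlo'' (Reg ''q'') ;; Assign ''hi'' (Reg ''h'') ;;
      Assign ''pos'' (Plus (Reg ''pos'') (Reg ''p'')) ;; inc ''l'' ;; Assign ''k'' (Const 0) ;;
      scale_loop ;;
      double ''V'')"

lemma written_key_loop [simp]: "written_regs key_loop = {''y'', ''k''}" "written_arrs key_loop = {}"
  by (auto simp: key_loop_def)

lemma written_rank_loop [simp]: "written_regs rank_loop = {''c'', ''d'', ''g'', ''u''}" "written_arrs rank_loop = {}"
  by (auto simp: rank_loop_def)

lemma written_add_loop [simp]: "written_regs add_loop = {''k''}" "written_arrs add_loop = {''A''}"
  by (auto simp: add_loop_def)

lemma written_emit_loop [simp]: "written_regs emit_loop = {''k'', ''E'', ''h'', ''u'', ''r''}"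
  "written_arrs emit_loop = {''id'', ''b'', ''A''}"
  by (auto simp: emit_loop_def)

lemma written_term_loop [simp]:
  "written_regs term_loop = {''y'', ''k'', ''c'', ''d'', ''g'', ''u'', ''r'', ''E'', ''h'', ''t'', ''q''}"
  "written_arrs term_loop = {''key'', ''d'', ''g'', ''id'', ''b'', ''A''}"
  by (auto simp: term_loop_def)

lemma written_scale_loop [simp]: "written_regs scale_loop = {''V'', ''M'', ''k''}" "written_arrs scale_loop = {}"
  by (auto simp: scale_loop_def)

section \<open>Correctness and running time of the loops\<close>

abbreviation nb :: "bit \<Rightarrow> nat" where
  "nb a \<equiv> of_bool (a = 1)"

lemma run_key_loop:
  assumes "regs c ''y'' = fst T" "regs c ''k'' = regs c ''pos''"
    and row: "\<And>k. k < regs c ''n'' \<Longrightarrow> arrs c ''A'' (regs c ''q'' + k) = nb (coord A T k)"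
    and "regs c ''n'' < Z"
  shows "run key_loop c (\<lambda>t c'. t \<le> 22 * Z \<and>
    regs c' ''y'' = block_key A (regs c ''pos'') (min (regs c ''n'') (regs c ''pos'' + regs c ''p'')) T)"
proof -
  let ?n = "regs c ''n''" and ?pos = "regs c ''pos''" and ?p = "regs c ''p''"
  let ?I = "\<lambda>i c'. regs c' ''y'' = block_key A ?pos (?pos + i) T \<and> regs c' ''k'' = ?pos + i"
  show ?thesis
    unfolding key_loop_def
  \<comment> \<open>The truncated difference gives zero iterations if the block starts beyond the
    last column.\<close>
  proof (rule run_While[where I = ?I and N = "min ?n (?pos + ?p) - ?pos" and \<tau> = 13 and Z = Z], goal_cases)
    case 1
    show ?case using assms by (simp add: block_key_def)
  next
    case (2 i c')
    note frame_regs[OF 2(3), simp] frame_arrs[OF 2(3), simp]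
    have "i < ?p" "?pos + i < ?n" using 2(1) by auto
    then show ?case
      using 2(2) row[of "?pos + i"] by (simp add: block_key_def)
  next
    case (3 c')
    note frame_regs[OF 3(2), simp]
    show ?case using 3(1) by (auto simp: min_def)
  next
    case 4
    show ?case using assms by auto
  next
    case (5 t c')
    then show ?case by (cases "?pos \<le> ?n") (auto simp: block_key_def min_def)
  qed
qed

lemma card_less_Suc_key:
  "card {u. u < Suc j \<and> P u} = (if P j then Suc (card {u. u < j \<and> P u}) else card {u. u < j \<and> P u})"
proof -
  have "{u. u < Suc j \<and> P u} = (if P j then insert j {u. u < j \<and> P u} else {u. u < j \<and> P u})"
    by (auto simp: less_Suc_eq)
  then show ?thesis by simp
qed

lemma run_rank_loop:
  assumes "regs c ''u'' = lo" "regs c ''t'' = lo + i" "regs c ''c'' = 0" "regs c ''d'' = 0" "regs c ''g'' = 0"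
    and y: "regs c ''y'' = K i" and K: "\<And>j. j < i \<Longrightarrow> arrs c ''key'' (lo + j) = K j"
    and s: "regs c ''s'' = s" "s > 0" and V: "regs c ''V'' = V" and "i < Z"
  shows "run rank_loop c (\<lambda>t c'. t \<le> 30 * Z \<and> regs c' ''c'' = class_rank K i mod s \<and>
    regs c' ''d'' = V * (class_rank K i mod s) \<and> regs c' ''g'' = class_rank K i div s)"
proof -
  let ?r = "\<lambda>j. card {u. u < j \<and> K u = K i}"
  let ?I = "\<lambda>j c'. regs c' ''u'' = lo + j \<and> regs c' ''c'' = ?r j mod s \<and>
    regs c' ''d'' = V * (?r j mod s) \<and> regs c' ''g'' = ?r j div s"
  show ?thesis
    unfolding rank_loop_def
  proof (rule run_While[where I = ?I and N = i and \<tau> = 27 and Z = Z], goal_cases)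
    case 1
    show ?case using assms by simp
  next
    case (2 j c')
    note frame_regs[OF 2(3), simp] frame_arrs[OF 2(3), simp]
    have "Suc (?r j) div s = (if Suc (?r j mod s) = s then Suc (?r j div s) else ?r j div s)"
      using s(2) by (auto simp: div_Suc mod_Suc)
    then show ?case
      using 2(1,2) assms K[of j] by (simp add: card_less_Suc_key mod_Suc)
  next
    case (3 c')
    note frame_regs[OF 3(2), simp]
    show ?case using 3(1) assms by simp
  next
    case 4
    show ?case by fact
  next
    case (5 t c')
    then show ?case by (simp add: class_rank_def)
  qed
qed

text \<open>Both source rows end at or before cell \<open>E\<close>, so writing the target row never
  destroys a bit that is still to be read.\<close>

lemma run_add_loop:
  assumes "regs c ''k'' = 0" and n: "regs c ''n'' = n" and r: "regs c ''r'' + n \<le> regs c ''E''"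
    and q: "regs c ''q'' + n \<le> regs c ''E''" and "n < Z"
  shows "run add_loop c (\<lambda>t c'. t \<le> 30 * Z \<and>
    (\<forall>k<n. arrs c' ''A'' (regs c ''E'' + k) =
       (arrs c ''A'' (regs c ''r'' + k) - arrs c ''A'' (regs c ''q'' + k)) +
       (arrs c ''A'' (regs c ''q'' + k) - arrs c ''A'' (regs c ''r'' + k))) \<and>
    (\<forall>x<regs c ''E''. arrs c' ''A'' x = arrs c ''A'' x))"
proof -
  let ?a = "arrs c ''A''"
  let ?I = "\<lambda>j c'. regs c' ''k'' = j \<and>
    (\<forall>k<j. arrs c' ''A'' (regs c ''E'' + k) =
       (?a (regs c ''r'' + k) - ?a (regs c ''q'' + k)) + (?a (regs c ''q'' + k) - ?a (regs c ''r'' + k))) \<and>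
    (\<forall>x<regs c ''E''. arrs c' ''A'' x = ?a x)"
  show ?thesis
    unfolding add_loop_def
  proof (rule run_While[where I = ?I and N = n and \<tau> = 27 and Z = Z], goal_cases)
    case 1
    show ?case using assms by simp
  next
    case (2 j c')
    note frame_regs[OF 2(3), simp]
    have "regs c ''r'' + j < regs c ''E''" "regs c ''q'' + j < regs c ''E''"
      using 2(1) r q by simp_all
    then show ?case
      using 2(1,2) n by (simp add: less_Suc_eq)
  next
    case (3 c')
    note frame_regs[OF 3(2), simp]
    show ?case using 3(1) n by simp
  next
    case 4
    show ?case by fact
  next
    case (5 t c')
    then show ?case by simp
  qed
qed

text \<open>The lists \<open>snd\<close> of equations exist only in the specification; identifiers,
  right-hand sides and coordinate sums are all that memory contains.\<close>

definition holds :: "bit mat \<Rightarrow> bit vec \<Rightarrow> (string \<Rightarrow> nat \<Rightarrow> nat) \<Rightarrow> nat \<Rightarrow> combination list \<Rightarrow> bool" where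
  "holds A b a lo xs \<longleftrightarrow> (\<forall>i<length xs. a ''id'' (lo + i) = fst (xs ! i) \<and>
     a ''b'' (lo + i) = nb (rhs b (xs ! i)) \<and>
     (\<forall>k<dim_col A. a ''A'' ((lo + i) * dim_col A + k) = nb (coord A (xs ! i) k)))"

lemma holds_Nil [simp]: "holds A b a lo []"
  by (simp add: holds_def)

lemma address_less:
  fixes i j k n :: nat
  assumes "i < j" "k < n"
  shows "i * n + k < j * n"
proof -
  have "i * n + k < Suc i * n" using assms by simp
  also have "\<dots> \<le> j * n" using assms by (intro mult_le_mono1) simp
  finally show ?thesis .
qed

lemma holds_cong:
  assumes "holds A b a lo xs" and h: "lo + length xs \<le> h"
    and id: "\<And>x. x < h \<Longrightarrow> a' ''id'' x = a ''id'' x"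
    and b: "\<And>x. x < h \<Longrightarrow> a' ''b'' x = a ''b'' x"
    and A: "\<And>x. x < h * dim_col A \<Longrightarrow> a' ''A'' x = a ''A'' x"
  shows "holds A b a' lo xs"
  unfolding holds_def
proof (intro allI impI)
  fix i assume i: "i < length xs"
  then have lt: "lo + i < h" using h by simp
  show "a' ''id'' (lo + i) = fst (xs ! i) \<and> a' ''b'' (lo + i) = nb (rhs b (xs ! i)) \<and>
    (\<forall>k<dim_col A. a' ''A'' ((lo + i) * dim_col A + k) = nb (coord A (xs ! i) k))"
    using assms(1) i id[OF lt] b[OF lt] A[OF address_less[OF lt]] unfolding holds_def by simp
qed

lemma holds_snoc:
  assumes "holds A b a lo zs"
    and "a ''id'' (lo + length zs) = fst T" "a ''b'' (lo + length zs) = nb (rhs b T)"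
    and "\<And>k. k < dim_col A \<Longrightarrow> a ''A'' ((lo + length zs) * dim_col A + k) = nb (coord A T k)"
  shows "holds A b a lo (zs @ [T])"
  using assms unfolding holds_def by (auto simp: nth_append less_Suc_eq)

lemma nb_add: "nb (a + b) = (nb a - nb b) + (nb b - nb a)"
  by (cases a; cases b) simp_all

lemma run_add_loop_holds:
  assumes k: "regs c ''k'' = 0" and n: "regs c ''n'' = dim_col A" and E: "regs c ''E'' = h * dim_col A"
    and r: "regs c ''r'' = u * dim_col A" and q: "regs c ''q'' = i * dim_col A" and lt: "u < h" "i < h"
    and rows: "\<And>k. k < dim_col A \<Longrightarrow> arrs c ''A'' (u * dim_col A + k) = nb (coord A U k)"
      "\<And>k. k < dim_col A \<Longrightarrow> arrs c ''A'' (i * dim_col A + k) = nb (coord A I k)"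
      "\<And>k. coord A T k = coord A U k + coord A I k"
    and T: "arrs c ''id'' h = fst T" "arrs c ''b'' h = nb (rhs b T)"
    and xs: "holds A b (arrs c) lo xs" "lo + length xs \<le> h" and zs: "holds A b (arrs c) hi zs" "h = hi + length zs"
    and Z: "dim_col A < Z"
  shows "run add_loop c (\<lambda>t c'. t \<le> 30 * Z \<and> holds A b (arrs c') lo xs \<and> holds A b (arrs c') hi (zs @ [T]))"
proof (rule run_frame[OF run_add_loop[OF k n _ _ Z]])
  have *: "i * n + n \<le> h * n" if "i < h" for i h n :: nat
    using that by (metis Suc_leI add.commute mult_Suc mult_le_mono1)
  show "regs c ''r'' + dim_col A \<le> regs c ''E''" "regs c ''q'' + dim_col A \<le> regs c ''E''"
    using * lt by (simp_all add: E r q)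
next
  fix t c'
  assume p: "t \<le> 30 * Z \<and>
    (\<forall>k<dim_col A. arrs c' ''A'' (regs c ''E'' + k) =
       (arrs c ''A'' (regs c ''r'' + k) - arrs c ''A'' (regs c ''q'' + k)) +
       (arrs c ''A'' (regs c ''q'' + k) - arrs c ''A'' (regs c ''r'' + k))) \<and>
    (\<forall>x<regs c ''E''. arrs c' ''A'' x = arrs c ''A'' x)"
    and fr: "frame add_loop c c'"
  note frame_arrs[OF fr, simp]
  have "holds A b (arrs c') lo xs"
    by (rule holds_cong[OF xs]) (use p E in simp_all)
  moreover have "holds A b (arrs c') hi zs"
    by (rule holds_cong[OF zs(1), of h]) (use p E zs in simp_all)
  then have "holds A b (arrs c') hi (zs @ [T])"
    by (rule holds_snoc) (use p E r q T zs(2) rows in \<open>simp_all add: nb_add del: of_bool_eq_iff\<close>)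
  ultimately show "t \<le> 30 * Z \<and> holds A b (arrs c') lo xs \<and> holds A b (arrs c') hi (zs @ [T])"
    using p by simp
qed

text \<open>In the invariant, \<open>new j i\<close> consists of the combinations for pairs
  \<open>(u, i)\<close> with \<open>u < j\<close>; at \<open>j = i\<close> it is the segment that
  \<open>pairs_Suc\<close> appends.\<close>

lemma run_emit_loop:
  fixes xs zs :: "combination list" and key :: "combination \<Rightarrow> nat" and s V lo :: nat
  defines "K \<equiv> \<lambda>i. key (xs ! i)"
  defines "hi \<equiv> lo + length xs"
  defines "new \<equiv> \<lambda>j i. map (combine key s V xs) (map (\<lambda>u. (u, i)) (filter (\<lambda>u. bucket K s u = bucket K s i) [0..<j]))"
  assumes n: "regs c ''n'' = dim_col A" and "regs c ''u'' = lo" and t: "regs c ''t'' = lo + i" and i: "i < length xs"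
    and "regs c ''h'' = hi + length zs" "regs c ''E'' = (hi + length zs) * dim_col A"
    and "regs c ''r'' = lo * dim_col A" and q: "regs c ''q'' = (lo + i) * dim_col A"
    and y: "regs c ''y'' = K i" and d: "regs c ''d'' = V * (class_rank K i mod s)" and g: "regs c ''g'' = class_rank K i div s"
    and keys: "\<And>j. j < i \<Longrightarrow> arrs c ''key'' (lo + j) = K j"
    and ds: "\<And>j. j < i \<Longrightarrow> arrs c ''d'' (lo + j) = V * (class_rank K j mod s)"
    and gs: "\<And>j. j < i \<Longrightarrow> arrs c ''g'' (lo + j) = class_rank K j div s"
    and xs: "holds A b (arrs c) lo xs" and zs: "holds A b (arrs c) hi zs"
    and Z: "i < Z" "dim_col A < Z"
  shows "run emit_loop c (\<lambda>t c'. t \<le> 82 * Z * Z \<and> holds A b (arrs c') lo xs \<and> holds A b (arrs c') hi (zs @ new i i) \<and>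
    regs c' ''h'' = hi + length (zs @ new i i) \<and> regs c' ''E'' = (hi + length (zs @ new i i)) * dim_col A)"
proof -
  let ?n = "dim_col A"
  let ?I = "\<lambda>j c'. regs c' ''u'' = lo + j \<and> regs c' ''r'' = (lo + j) * ?n \<and>
    holds A b (arrs c') lo xs \<and> holds A b (arrs c') hi (zs @ new j i) \<and>
    regs c' ''h'' = hi + length (zs @ new j i) \<and> regs c' ''E'' = (hi + length (zs @ new j i)) * ?n"
  show ?thesis
    unfolding emit_loop_def
  proof (rule run_While[where I = ?I and N = i and \<tau> = "79 * Z" and Z = Z], goal_cases)
    case 1
    show ?case using assms by simp
  next
    case (2 j c')
    note fr [simp] = frame_regs[OF 2(3)] frame_arrs[OF 2(3)]
    note I = 2(2)
    have j: "j < i" "j < length xs" using 2(1) i by auto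
    have b_iff: "bucket K s j = bucket K s i \<longleftrightarrow> K j = K i \<and> class_rank K j div s = class_rank K i div s"
      by (simp add: bucket_def)
    show ?case
    proof (cases "bucket K s j = bucket K s i")
      case False
      then have "new (Suc j) i = new j i" by (simp add: new_def)
      then show ?thesis
        using False I j n t y g keys[of j] gs[of j] Z by (cases "K j = K i") (simp_all add: b_iff)
    next
      case True
      let ?T = "combine key s V xs (j, i)" and ?h = "hi + length (zs @ new j i)"
      have new: "new (Suc j) i = new j i @ [?T]" using True by (simp add: new_def)
      have lt: "lo + j < ?h" "lo + i < ?h" using j i by (auto simp: hi_def)
      have row: "k < ?n \<Longrightarrow> arrs c' ''A'' ((lo + j') * ?n + k) = nb (coord A (xs ! j') k)"
        "arrs c' ''b'' (lo + j') = nb (rhs b (xs ! j'))" "arrs c' ''id'' (lo + j') = fst (xs ! j')"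
        if "j' < length xs" for j' k
        using I that unfolding holds_def by blast+
      have T: "fst ?T = fst (xs ! i) + (V * (class_rank K j mod s) + V * (class_rank K i mod s))"
        by (simp add: combine_def K_def)
      have upd: "holds A b ((arrs c')(''id'' := (arrs c' ''id'')(?h := v), ''b'' := (arrs c' ''b'')(?h := w))) lo xs"
        "holds A b ((arrs c')(''id'' := (arrs c' ''id'')(?h := v), ''b'' := (arrs c' ''b'')(?h := w))) hi (zs @ new j i)"
        for v w
        by (rule holds_cong[of A b "arrs c'" _ _ ?h]; use I in \<open>simp add: hi_def\<close>)+
      have Tid: "arrs c' ''id'' (lo + i) + (arrs c ''d'' (lo + j) + regs c ''d'') = fst ?T"
        using row(3)[OF i] ds[OF j(1)] d by (simp add: T)
      define w where "w = nb (rhs b ?T)"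
      have Tb: "(arrs c' ''b'' (lo + j) - arrs c' ''b'' (lo + i)) + (arrs c' ''b'' (lo + i) - arrs c' ''b'' (lo + j)) = w"
        unfolding w_def rhs_combine nb_add row(2)[OF i] row(2)[OF j(2)] ..
      have K: "K j = K i" "class_rank K j div s = class_rank K i div s" using True b_iff by auto
      \<comment> \<open>The state just before \<open>add_loop\<close>: identifier and right-hand
        side of the new combination are written, its row is not.\<close>
      define c1 where "c1 = Config ((regs c')(''k'' := 0))
        ((arrs c')(''id'' := (arrs c' ''id'')(?h := fst ?T), ''b'' := (arrs c' ''b'')(?h := w))) (coins c')"
      have "run add_loop c1 (\<lambda>t c'. t \<le> 30 * Z \<and> holds A b (arrs c') lo xs \<and>
          holds A b (arrs c') hi ((zs @ new j i) @ [?T]))"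
        by (rule run_add_loop_holds[where u = "lo + j" and i = "lo + i" and U = "xs ! j" and I = "xs ! i" and h = ?h])
          (use I lt row j i upd coord_combine n q Z in \<open>simp_all add: c1_def w_def hi_def\<close>)
      note add = run_frame[OF this]
      have I': "regs c' ''h'' = ?h" "regs c' ''u'' = lo + j" "regs c' ''r'' = (lo + j) * ?n" "regs c' ''E'' = ?h * ?n"
        using I by auto
      show ?thesis
        using j(1) t y g n keys[OF j(1)] gs[OF j(1)] K
        apply (simp add: I' Tid Tb del: length_append)
        apply (subst c1_def[symmetric])
        apply (rule add)
        subgoal for t c''
          using I' n Z
          by (simp add: frame_def c1_def new algebra_simps)
        done
    qed
  next
    case (3 c')
    note frame_regs[OF 3(2), simp]
    show ?case using 3(1) t by simp
  next
    case 4
    show ?case by fact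
  next
    case (5 t c')
    have "(bcost (Less (Reg ''u'') (Reg ''t'')) + 79 * Z) * Z \<le> 82 * Z * Z"
      using Z by (intro mult_le_mono1) simp
    then show ?case using 5 by (auto intro: order_trans)
  qed
qed

lemma frame_no_arrs:
  assumes "written_arrs p = {}"
  shows "frame p c c' \<longleftrightarrow> arrs c' = arrs c \<and> (\<forall>x. x \<notin> written_regs p \<longrightarrow> regs c' x = regs c x)"
  using assms by (auto simp: frame_def)

lemma holds_update [simp]:
  "x \<notin> {''id'', ''b'', ''A''} \<Longrightarrow> holds A b (a(x := v)) lo xs \<longleftrightarrow> holds A b a lo xs"
  by (auto simp: holds_def)

lemma run_term_loop:
  fixes xs :: "combination list" and lo pos p s V :: nat and A :: "bit mat"
  defines "key \<equiv> block_key A pos (min (dim_col A) (pos + p))"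
  defines "hi \<equiv> lo + length xs"
  assumes n: "regs c ''n'' = dim_col A" and lo: "regs c ''lo'' = lo" "regs c ''qlo'' = lo * dim_col A"
    and hi: "regs c ''hi'' = hi" and p: "regs c ''pos'' = pos" "regs c ''p'' = p"
    and s: "regs c ''s'' = s" "s > 0" and V: "regs c ''V'' = V"
    and start: "regs c ''t'' = lo" "regs c ''q'' = lo * dim_col A" "regs c ''h'' = hi" "regs c ''E'' = hi * dim_col A"
    and xs: "holds A b (arrs c) lo xs"
    and Z: "length xs < Z" "dim_col A < Z"
  shows "run term_loop c (\<lambda>t c'. t \<le> 171 * Z * Z * Z \<and> holds A b (arrs c') hi (step key s V xs) \<and>
    regs c' ''h'' = hi + length (step key s V xs) \<and>
    regs c' ''E'' = (hi + length (step key s V xs)) * dim_col A \<and> regs c' ''q'' = hi * dim_col A)"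
proof -
  let ?n = "dim_col A"
  define K where "K = (\<lambda>i. key (xs ! i))"
  define new where "new i = map (combine key s V xs) (pairs K s i)" for i
  let ?I = "\<lambda>i c'. regs c' ''t'' = lo + i \<and> regs c' ''q'' = (lo + i) * ?n \<and>
    (\<forall>j<i. arrs c' ''key'' (lo + j) = K j \<and> arrs c' ''d'' (lo + j) = V * (class_rank K j mod s) \<and>
       arrs c' ''g'' (lo + j) = class_rank K j div s) \<and>
    holds A b (arrs c') lo xs \<and> holds A b (arrs c') hi (new i) \<and>
    regs c' ''h'' = hi + length (new i) \<and> regs c' ''E'' = (hi + length (new i)) * ?n"
  show ?thesis
    unfolding term_loop_def
  proof (rule run_While[where I = ?I and N = "length xs" and \<tau> = "168 * Z * Z" and Z = Z], goal_cases)
    case 1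
    show ?case using assms by (simp add: new_def)
  next
    case (2 i c')
    have fr: "regs c' ''n'' = ?n" "regs c' ''lo'' = lo" "regs c' ''qlo'' = lo * ?n" "regs c' ''hi'' = hi"
      "regs c' ''pos'' = pos" "regs c' ''p'' = p" "regs c' ''s'' = s" "regs c' ''V'' = V"
      using frame_regs[OF 2(3)] n lo hi p s V by simp_all
    note I = 2(2)
    have i: "i < length xs" by fact
    then have iZ: "i < Z" using Z by simp
    have row: "arrs c' ''A'' ((lo + i) * ?n + k) = nb (coord A (xs ! i) k)" if "k < ?n" for k
      using I i that unfolding holds_def by blast
    have idi: "arrs c' ''id'' (lo + i) = fst (xs ! i)"
      using I i unfolding holds_def by blast
    have new: "new (Suc i) = new i @
        map (combine key s V xs) (map (\<lambda>u. (u, i)) (filter (\<lambda>u. bucket K s u = bucket K s i) [0..<i]))"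
      by (simp add: new_def pairs_Suc)
    have Kf: "key (xs ! j) = K j" for j by (simp add: K_def)
    have Z1: "Z \<le> Z * Z" "1 \<le> Z * Z" using Z by (simp_all add: Suc_le_eq)
    have "bval (Less (Reg ''t'') (Reg ''hi'')) c'" using I i fr by (simp add: hi_def)
    moreover have "run (Assign ''y'' (Read ''id'' (Reg ''t'')) ;; Assign ''k'' (Reg ''pos'') ;;
      key_loop ;;
      Write ''key'' (Reg ''t'') (Reg ''y'') ;;
      Assign ''c'' (Const 0) ;; Assign ''d'' (Const 0) ;; Assign ''g'' (Const 0) ;; Assign ''u'' (Reg ''lo'') ;;
      rank_loop ;;
      Write ''d'' (Reg ''t'') (Reg ''d'') ;; Write ''g'' (Reg ''t'') (Reg ''g'') ;;
      Assign ''u'' (Reg ''lo'') ;; Assign ''r'' (Reg ''qlo'') ;;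
      emit_loop ;;
      inc ''t'' ;; Assign ''q'' (Plus (Reg ''q'') (Reg ''n''))) c' (\<lambda>t c''. t \<le> 168 * Z * Z \<and> ?I (Suc i) c'')"
      using I
      apply (simp add: fr idi)
      apply (rule run_frame[OF run_key_loop[where T = "xs ! i" and A = A and Z = Z]])
          apply (simp_all add: fr row Z)[4]
      apply (simp add: frame_no_arrs fr key_def[symmetric] Kf)
      apply (rule run_frame[OF run_rank_loop[where lo = lo and i = i and K = K and V = V and s = s and Z = Z]])
                apply (simp_all add: fr Kf s iZ)[11]
      apply (simp add: frame_no_arrs fr)
      apply (rule run_frame[OF run_emit_loop[where xs = xs and zs = "new i" and key = key and s = s and V = V and
            lo = lo and i = i and A = A and b = b and Z = Z]])
                         apply (simp_all add: fr i iZ Z Kf hi_def[symmetric])[18]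
      apply (simp add: frame_def fr Kf hi_def[symmetric])
      apply (simp add: new)
      subgoal premises prems for t _ t' _ t''
      proof -
        have "t \<le> 22 * Z" "t' \<le> 30 * Z" "t'' \<le> 82 * Z * Z" using prems by blast+
        then show ?thesis using Z1 by (simp only: mult.assoc)
      qed
      done
    ultimately show ?case by blast
  next
    case (3 c')
    note frame_regs[OF 3(2), simp]
    show ?case using 3(1) hi by (simp add: hi_def)
  next
    case 4
    show ?case by fact
  next
    case (5 t c')
    have "(bcost (Less (Reg ''t'') (Reg ''hi'')) + 168 * Z * Z) * Z \<le> 171 * Z * Z * Z"
    proof (intro mult_le_mono1)
      have "1 \<le> Z * Z" using Z by (simp add: Suc_le_eq)
      then show "bcost (Less (Reg ''t'') (Reg ''hi'')) + 168 * Z * Z \<le> 171 * Z * Z" by simp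
    qed
    then show ?case using 5 by (auto simp: step_def new_def K_def hi_def intro: order_trans)
  qed
qed


lemma run_scale_loop:
  assumes "regs c ''k'' = 0" and W: "regs c ''W'' = w" and "w < Z"
  shows "run scale_loop c (\<lambda>t c'. t \<le> 15 * Z \<and> regs c' ''V'' = regs c ''V'' * 2 ^ w \<and> regs c' ''M'' = regs c ''M'' * 2 ^ w)"
proof -
  let ?I = "\<lambda>i c'. regs c' ''k'' = i \<and> regs c' ''V'' = regs c ''V'' * 2 ^ i \<and> regs c' ''M'' = regs c ''M'' * 2 ^ i"
  show ?thesis
    unfolding scale_loop_def
  proof (rule run_While[where I = ?I and N = w and \<tau> = 12 and Z = Z], goal_cases)
    case (2 i c')
    note frame_regs[OF 2(3), simp]
    show ?case using 2(1,2) W by simp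
  next
    case (3 c')
    note frame_regs[OF 3(2), simp]
    show ?case using 3(1) W by simp
  qed (use assms in simp_all)
qed

text \<open>Earlier levels stay in memory, so the invariant locates the current one only through the
  register \<open>lo\<close>.\<close>

lemma run_level_loop:
  fixes A :: "bit mat"
  assumes n: "regs c ''n'' = dim_col A" and L: "regs c ''L'' = L" and p: "regs c ''p'' = p" and W: "regs c ''W'' = w"
    and s: "s = 2 ^ w" "regs c ''s'' = s"
    and start: "regs c ''l'' = 0" "regs c ''pos'' = 0" "regs c ''lo'' = 0" "regs c ''qlo'' = 0" "regs c ''hi'' = dim_row A"
      "regs c ''h'' = dim_row A" "regs c ''E'' = dim_row A * dim_col A" "regs c ''V'' = 1" "regs c ''M'' = dim_row A"
    and h0: "holds A b (arrs c) 0 (level A s p 0)"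
    and Z: "\<And>l. l \<le> L \<Longrightarrow> length (level A s p l) < Z" "dim_col A < Z" "L < Z" "w < Z"
  shows "run level_loop c (\<lambda>t c'. t \<le> 215 * Z * Z * Z * Z \<and> holds A b (arrs c') (regs c' ''lo'') (level A s p L) \<and>
    regs c' ''hi'' = regs c' ''lo'' + length (level A s p L) \<and> regs c' ''M'' = dim_row A * s ^ L)"
proof -
  let ?n = "dim_col A"
  let ?I = "\<lambda>l c'. regs c' ''l'' = l \<and> regs c' ''pos'' = l * p \<and> holds A b (arrs c') (regs c' ''lo'') (level A s p l) \<and>
    regs c' ''hi'' = regs c' ''lo'' + length (level A s p l) \<and> regs c' ''qlo'' = regs c' ''lo'' * ?n \<and>
    regs c' ''h'' = regs c' ''hi'' \<and> regs c' ''E'' = regs c' ''hi'' * ?n \<and> regs c' ''V'' = (2 * s) ^ l \<and>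
    regs c' ''M'' = dim_row A * s ^ l"
  have "s > 0" by (simp add: s)
  have ZZ: "1 \<le> Z * Z * Z" "Z \<le> Z * Z * Z" using Z by (simp_all add: Suc_le_eq)
  show ?thesis
    unfolding level_loop_def
  proof (rule run_While[where I = ?I and N = L and \<tau> = "212 * Z * Z * Z" and Z = Z], goal_cases)
    case 1
    show ?case using start h0 by simp
  next
    case (2 l c')
    have fr: "regs c' ''n'' = ?n" "regs c' ''L'' = L" "regs c' ''p'' = p" "regs c' ''W'' = w" "regs c' ''s'' = s"
      using frame_regs[OF 2(3)] n L p W s(2) by simp_all
    note I = 2(2)
    have Zl: "length (level A s p l) < Z" using Z(1) \<open>l < L\<close> by simp
    have "bval (Less (Reg ''l'') (Reg ''L'')) c'" using I \<open>l < L\<close> fr by simp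
    moreover have "run (Assign ''t'' (Reg ''lo'') ;; Assign ''q'' (Reg ''qlo'') ;;
      term_loop ;;
      Assign ''lo'' (Reg ''hi'') ;; Assign ''qlo'' (Reg ''q'') ;; Assign ''hi'' (Reg ''h'') ;;
      Assign ''pos'' (Plus (Reg ''pos'') (Reg ''p'')) ;; inc ''l'' ;; Assign ''k'' (Const 0) ;;
      scale_loop ;;
      double ''V'') c' (\<lambda>t c''. t \<le> 212 * Z * Z * Z \<and> ?I (Suc l) c'')"
      using I
      apply (simp add: fr del: level.simps)
      apply (rule run_frame[OF run_term_loop[where xs = "level A s p l" and lo = "regs c' ''lo''" and pos = "l * p" and p = p
            and s = s and V = "(2 * s) ^ l" and A = A and b = b and Z = Z]])
                     apply (simp_all add: fr Zl Z \<open>s > 0\<close> del: level.simps)[16]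
      apply (simp add: frame_def fr level.simps(2)[symmetric] del: level.simps)
      apply (rule run_frame[OF run_scale_loop[where w = w and Z = Z]])
         apply (simp_all add: fr Z del: level.simps)[3]
      apply (simp add: frame_no_arrs fr del: level.simps)
      apply (rule conjI)
      subgoal premises prems for t _ t' _
      proof -
        have "t \<le> 171 * Z * Z * Z" "t' \<le> 15 * Z" using prems by blast+
        then show ?thesis using ZZ by (simp only: mult.assoc)
      qed
      apply (simp add: algebra_simps s(1) power_mult_distrib del: level.simps(1))
      done
    ultimately show ?case by blast
  next
    case (3 c')
    note frame_regs[OF 3(2), simp]
    show ?case using 3(1) L by simp
  next
    case 4
    show ?case by fact
  next
    case (5 t c')
    have "(bcost (Less (Reg ''l'') (Reg ''L'')) + 212 * Z * Z * Z) * Z \<le> 215 * Z * Z * Z * Z"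
      using ZZ by (intro mult_le_mono1) simp
    then show ?case using 5 by (auto simp del: level.simps intro: order_trans)
  qed
qed

text \<open>The threshold is put into \<open>x\<close> beforehand. Positive signs add
  \<open>s\<close> to \<open>y\<close> and negative ones add \<open>s\<close> to \<open>x\<close>,
  which turns a signed comparison into \<open>x < y\<close> on natural numbers.\<close>

definition final_loop :: com where
  "final_loop = While (Less (Reg ''t'') (Reg ''hi''))
     (Cond (Equal (Read ''b'' (Reg ''t'')) (Const 0))
        (Assign ''y'' (Plus (Reg ''y'') (Reg ''s'')))
        (Assign ''x'' (Plus (Reg ''x'') (Reg ''s''))) ;;
      inc ''t'')"

lemma run_final_loop:
  assumes lo: "regs c ''t'' = lo" and hi: "regs c ''hi'' = lo + length xs" and s: "regs c ''s'' = s"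
    and start: "regs c ''y'' = 0" and xs: "holds A b (arrs c) lo xs" and "length xs < Z"
  shows "run final_loop c (\<lambda>t c'. t \<le> 15 * Z \<and>
    (regs c' ''x'' < regs c' ''y'' \<longleftrightarrow> \<not> (\<Sum>T\<leftarrow>xs. sg (rhs b T)) * real s \<le> real (regs c ''x'')))"
proof -
  let ?x = "regs c ''x''"
  let ?I = "\<lambda>i c'. regs c' ''t'' = lo + i \<and>
    real (regs c' ''y'') - real (regs c' ''x'') = (\<Sum>T\<leftarrow>take i xs. sg (rhs b T)) * real s - real ?x"
  show ?thesis
    unfolding final_loop_def
  proof (rule run_While[where I = ?I and N = "length xs" and \<tau> = 12 and Z = Z], goal_cases)
    case (2 i c')
    note frame_regs[OF 2(3), simp] frame_arrs[OF 2(3), simp]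
    have "arrs c ''b'' (lo + i) = nb (rhs b (xs ! i))"
      using xs 2(1) unfolding holds_def by blast
    then show ?case
      using 2(1,2) hi s
      by (cases "rhs b (xs ! i)") (simp_all add: take_Suc_conv_app_nth sg_def algebra_simps)
  next
    case (3 c')
    note frame_regs[OF 3(2), simp]
    show ?case using 3(1) hi by simp
  next
    case (5 t c')
    then show ?case by auto
  qed (use assms in simp_all)
qed

definition pow_loop :: "string \<Rightarrow> string \<Rightarrow> com" where
  "pow_loop x y = While (Less (Reg ''k'') (Reg y)) (double x ;; inc ''k'')"

lemma written_pow_loop [simp]: "written_regs (pow_loop x y) = {x, ''k''}" "written_arrs (pow_loop x y) = {}"
  by (auto simp: pow_loop_def)

lemma run_pow_loop:
  assumes "regs c ''k'' = 0" and y: "regs c y = e" and "e < Z" and "x \<noteq> ''k''" "y \<noteq> ''k''" "x \<noteq> y"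
  shows "run (pow_loop x y) c (\<lambda>t c'. t \<le> 11 * Z \<and> regs c' x = regs c x * 2 ^ e)"
proof -
  let ?I = "\<lambda>i c'. regs c' ''k'' = i \<and> regs c' x = regs c x * 2 ^ i"
  show ?thesis
    unfolding pow_loop_def
  proof (rule run_While[where I = ?I and N = e and \<tau> = 8 and Z = Z], goal_cases)
    case (2 i c')
    note frame_regs[OF 2(3), simp]
    show ?case using 2(1,2) assms by simp
  next
    case (3 c')
    note frame_regs[OF 3(2), simp]
    show ?case using 3(1) assms by simp
  qed (use assms in simp_all)
qed

text \<open>Each round multiplies \<open>P\<close>, \<open>G\<close>, \<open>W\<close>,
  \<open>U\<close> by 32, 4, 16, 24 through additions. Stopping once \<open>P\<close> exceeds
  \<open>n\<close> replaces the computation of a logarithm.\<close>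

definition param_loop :: com where
  "param_loop = While (Neg (Less (Reg ''n'') (Reg ''P'')))
     (double ''P'' ;; double ''P'' ;; double ''P'' ;; double ''P'' ;; double ''P'' ;;
      double ''G'' ;; double ''G'' ;;
      double ''W'' ;; double ''W'' ;; double ''W'' ;; double ''W'' ;;
      Assign ''L'' (Plus (Reg ''L'') (Const 2)) ;;
      Assign ''U'' (Plus (Plus (Reg ''U'') (Reg ''U'')) (Reg ''U'')) ;; double ''U'' ;; double ''U'' ;; double ''U'')"

text \<open>
  The exponent \<open>j = extra n + 1\<close> satisfies \<open>32 ^ j \<le> n < 32 ^ (j + 1)\<close> for \<open>n \<ge> 1024\<close>. The parameters
  are \<open>L = 2 j\<close>, \<open>G = 4 ^ j = 2 ^ L\<close>, \<open>W = 16 ^ j = log s\<close>, and \<open>U = 8 * 24 ^ j\<close>, which exceeds \<open>L * W\<close>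
  but is still of smaller order than \<open>n / log n\<close>.
\<close>

definition extra :: "nat \<Rightarrow> nat" where
  "extra n = (LEAST i. n < 32 ^ (i + 2))"

lemma extra: "n < 32 ^ (extra n + 2)" "i < extra n \<Longrightarrow> 32 ^ (i + 2) \<le> n" "extra n \<le> n"
proof -
  have "n < 32 ^ n" by (rule less_exp[THEN less_le_trans]) (simp add: power_mono)
  also have "(32::nat) ^ n \<le> 32 ^ (n + 2)" by (rule power_increasing) auto
  finally have n: "n < 32 ^ (n + 2)" .
  then show "n < 32 ^ (extra n + 2)" unfolding extra_def by (rule LeastI)
  show "extra n \<le> n" unfolding extra_def using n by (rule Least_le)
  show "32 ^ (i + 2) \<le> n" if "i < extra n"
    using not_less_Least[OF that[unfolded extra_def]] by simp
qed

lemma written_param_loop [simp]: "written_regs param_loop = {''P'', ''G'', ''W'', ''L'', ''U''}" "written_arrs param_loop = {}"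
  by (auto simp: param_loop_def)

lemma run_param_loop:
  assumes n: "regs c ''n'' = n" and start: "regs c ''P'' = 1024" "regs c ''G'' = 4" "regs c ''W'' = 16" "regs c ''L'' = 2" "regs c ''U'' = 192"
    and "n < Z"
  shows "run param_loop c (\<lambda>t c'. t \<le> 70 * Z \<and> regs c' ''G'' = 4 ^ (extra n + 1) \<and> regs c' ''W'' = 16 ^ (extra n + 1) \<and>
    regs c' ''L'' = 2 * (extra n + 1) \<and> regs c' ''U'' = 8 * 24 ^ (extra n + 1))"
proof -
  let ?I = "\<lambda>i c'. regs c' ''P'' = 32 ^ (i + 2) \<and> regs c' ''G'' = 4 ^ (i + 1) \<and> regs c' ''W'' = 16 ^ (i + 1) \<and>
    regs c' ''L'' = 2 * (i + 1) \<and> regs c' ''U'' = 8 * 24 ^ (i + 1)"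
  show ?thesis
    unfolding param_loop_def
  proof (rule run_While[where I = ?I and N = "extra n" and \<tau> = 66 and Z = Z], goal_cases)
    case (2 i c')
    note frame_regs[OF 2(3), simp]
    show ?case using 2(2) extra(2)[OF 2(1)] n by simp
  next
    case (3 c')
    note frame_regs[OF 3(2), simp]
    show ?case using 3(1) extra(1)[of n] n by simp
  next
    case 4
    show ?case using extra(3)[of n] \<open>n < Z\<close> by simp
  qed (use assms in simp_all)
qed

definition block_loop :: com where
  "block_loop = While (Less (Reg ''z'') (Reg ''n''))
     (Assign ''z'' (Plus (Reg ''z'') (Reg ''L'')) ;; inc ''p'' ;; double ''Q'')"

text \<open>For positive \<open>L\<close> this is the ceiling of \<open>n / L\<close>, phrased as
  the number of rounds of \<open>block_loop\<close>.\<close>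

definition blocks :: "nat \<Rightarrow> nat \<Rightarrow> nat" where
  "blocks n L = (LEAST p. n \<le> p * L)"

lemma blocks:
  assumes "L > 0"
  shows "n \<le> blocks n L * L" "i < blocks n L \<Longrightarrow> i * L < n" "blocks n L \<le> n"
proof -
  have n: "n \<le> n * L" using assms by simp
  show "n \<le> blocks n L * L" unfolding blocks_def using n by (rule LeastI)
  show "blocks n L \<le> n" unfolding blocks_def using n by (rule Least_le)
  show "i * L < n" if "i < blocks n L"
    using not_less_Least[OF that[unfolded blocks_def]] by simp
qed

lemma written_block_loop [simp]: "written_regs block_loop = {''z'', ''p'', ''Q''}" "written_arrs block_loop = {}"
  by (auto simp: block_loop_def)

lemma run_block_loop:
  assumes n: "regs c ''n'' = n" and L: "regs c ''L'' = L" "L > 0" and start: "regs c ''z'' = 0" "regs c ''p'' = 0"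
    and "n < Z"
  shows "run block_loop c (\<lambda>t c'. t \<le> 15 * Z \<and> regs c' ''p'' = blocks n L \<and> regs c' ''Q'' = regs c ''Q'' * 2 ^ blocks n L)"
proof -
  let ?I = "\<lambda>i c'. regs c' ''z'' = i * L \<and> regs c' ''p'' = i \<and> regs c' ''Q'' = regs c ''Q'' * 2 ^ i"
  show ?thesis
    unfolding block_loop_def
  proof (rule run_While[where I = ?I and N = "blocks n L" and \<tau> = 12 and Z = Z], goal_cases)
    case (2 i c')
    note frame_regs[OF 2(3), simp]
    show ?case using 2(2) blocks(2)[OF L(2) 2(1)] n L by simp
  next
    case (3 c')
    note frame_regs[OF 3(2), simp]
    show ?case using 3(1) blocks(1)[OF L(2), of n] n by simp
  next
    case 4
    show ?case using blocks(3)[OF L(2), of n] \<open>n < Z\<close> by simp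
  qed (use assms in simp_all)
qed

definition size_loop :: com where
  "size_loop = While (Less (Reg ''k'') (Reg ''m'')) (Assign ''E'' (Plus (Reg ''E'') (Reg ''n'')) ;; inc ''k'')"

lemma written_size_loop [simp]: "written_regs size_loop = {''E'', ''k''}" "written_arrs size_loop = {}"
  by (auto simp: size_loop_def)

lemma run_size_loop:
  assumes "regs c ''k'' = 0" "regs c ''E'' = 0" and m: "regs c ''m'' = m" and n: "regs c ''n'' = n" and "m < Z"
  shows "run size_loop c (\<lambda>t c'. t \<le> 11 * Z \<and> regs c' ''E'' = m * n)"
proof -
  let ?I = "\<lambda>i c'. regs c' ''k'' = i \<and> regs c' ''E'' = i * n"
  show ?thesis
    unfolding size_loop_def
  proof (rule run_While[where I = ?I and N = m and \<tau> = 8 and Z = Z], goal_cases)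
    case (2 i c')
    note frame_regs[OF 2(3), simp]
    show ?case using 2(1,2) m n by simp
  next
    case (3 c')
    note frame_regs[OF 3(2), simp]
    show ?case using 3(1) m by simp
  qed (use assms in simp_all)
qed

lemma written_level_loop [simp]:
  "written_regs level_loop = {''t'', ''q'', ''y'', ''k'', ''c'', ''d'', ''g'', ''u'', ''r'', ''E'', ''h'', ''lo'', ''qlo'', ''hi'',
     ''pos'', ''l'', ''V'', ''M''}"
  "written_arrs level_loop = {''key'', ''d'', ''g'', ''id'', ''b'', ''A''}"
  by (auto simp: level_loop_def)

lemma written_final_loop [simp]: "written_regs final_loop = {''y'', ''x'', ''t''}" "written_arrs final_loop = {}"
  by (auto simp: final_loop_def)

section \<open>Assembly of the algorithm\<close>

definition setup_part :: com where
  "setup_part =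
     (Assign ''num'' (Const 1) ;; Assign ''den'' (Const 1) ;; Assign ''P'' (Const 1024) ;; Assign ''G'' (Const 4) ;;
      Assign ''W'' (Const 16) ;; Assign ''L'' (Const 2) ;; Assign ''U'' (Const 192) ;; param_loop ;;
      Assign ''s'' (Const 1) ;; Assign ''k'' (Const 0) ;; pow_loop ''s'' ''W'' ;;
      Assign ''T'' (Const 1) ;; Assign ''k'' (Const 0) ;; pow_loop ''T'' ''G'' ;;
      Assign ''Q'' (Const 1) ;; Assign ''k'' (Const 0) ;; pow_loop ''Q'' ''U'' ;; block_loop)"

text \<open>With \<open>T = 2 ^ 2 ^ L\<close> the fraction \<open>(T + 5) / (2 * T)\<close> is the
  bound of \<open>certificate\<close>.\<close>

definition refute_part :: com where
  "refute_part =
     (Assign ''hi'' (Reg ''m'') ;; Assign ''h'' (Reg ''m'') ;; Assign ''k'' (Const 0) ;; size_loop ;;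
      Assign ''V'' (Const 1) ;; Assign ''M'' (Reg ''m'') ;; level_loop ;;
      Assign ''x'' (Reg ''M'') ;; Assign ''t'' (Reg ''lo'') ;; Assign ''y'' (Const 0) ;; final_loop ;;
      Cond (Less (Reg ''x'') (Reg ''y'')) Skip
        (Assign ''num'' (Plus (Reg ''T'') (Const 5)) ;; Assign ''den'' (Plus (Reg ''T'') (Reg ''T''))))"

text \<open>The default output is the trivial bound 1. The guard on \<open>Q\<close> both makes
  \<open>certificate\<close> applicable and keeps the levels polynomial in \<open>m\<close>. No
  \<open>Flip\<close> occurs, so the algorithm is deterministic.\<close>

definition algorithm :: com where
  "algorithm = (setup_part ;; Cond (Less (Reg ''m'') (Reg ''Q'')) Skip refute_part)"

lemma written_setup_part [simp]:
  "written_regs setup_part = {''num'', ''den'', ''P'', ''G'', ''W'', ''L'', ''U'', ''s'', ''k'', ''T'', ''Q'', ''z'', ''p''}"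
  "written_arrs setup_part = {}"
  by (auto simp: setup_part_def)

lemma param_bounds:
  fixes j :: nat
  shows "(4::nat) ^ j \<le> 8 * 24 ^ j" "(16::nat) ^ j \<le> 8 * 24 ^ j" "2 * j \<le> 8 * 24 ^ j"
proof -
  show "(4::nat) ^ j \<le> 8 * 24 ^ j" "(16::nat) ^ j \<le> 8 * 24 ^ j"
    by (rule order_trans[OF power_mono[of _ 24]]; simp)+
  have "j < 2 ^ j" by (rule less_exp)
  also have "(2::nat) ^ j \<le> 24 ^ j" by (rule power_mono) auto
  finally show "2 * j \<le> 8 * 24 ^ j" by simp
qed

lemma run_setup_part:
  fixes n Z :: nat
  defines "j \<equiv> extra n + 1"
  assumes n: "regs c ''n'' = n" and start: "regs c ''z'' = 0" "regs c ''p'' = 0"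
    and Z: "n < Z" "8 * 24 ^ j < Z"
  shows "run setup_part c (\<lambda>t c'. t \<le> 150 * Z \<and> regs c' ''num'' = 1 \<and> regs c' ''den'' = 1 \<and>
    regs c' ''T'' = 2 ^ 4 ^ j \<and> regs c' ''W'' = 16 ^ j \<and> regs c' ''L'' = 2 * j \<and> regs c' ''s'' = 2 ^ 16 ^ j \<and>
    regs c' ''p'' = blocks n (2 * j) \<and> regs c' ''Q'' = 2 ^ (8 * 24 ^ j + blocks n (2 * j)))"
proof -
  have Z': "4 ^ j < Z" "16 ^ j < Z"
    using param_bounds[of j] Z by simp_all
  have j0: "0 < j" by (simp add: j_def)
  show ?thesis
    unfolding setup_part_def
    apply simp
    apply (rule run_frame[OF run_param_loop[where n = n and Z = Z]])
           apply (simp_all add: n Z)[7]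
    apply (simp add: frame_no_arrs j_def[symmetric, simplified])
    apply (rule run_frame[OF run_pow_loop[where e = "16 ^ j" and Z = Z]])
          apply (simp_all add: Z')[6]
    apply (simp add: frame_no_arrs)
    apply (rule run_frame[OF run_pow_loop[where e = "4 ^ j" and Z = Z]])
          apply (simp_all add: Z')[6]
    apply (simp add: frame_no_arrs)
    apply (rule run_frame[OF run_pow_loop[where e = "8 * 24 ^ j" and Z = Z]])
          apply (simp_all add: Z)[6]
    apply (simp add: frame_no_arrs)
    apply (rule run_frame[OF run_block_loop[where n = n and L = "2 * j" and Z = Z]])
          apply (simp_all add: n start Z j0)[6]
    apply (use Z in \<open>simp add: frame_no_arrs power_add\<close>)
    done
qed

lemma run_refute_part:
  fixes A :: "bit mat"
  assumes A: "A \<in> carrier_mat m n" and m: "regs c ''m'' = m" and n: "regs c ''n'' = n"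
    and L: "regs c ''L'' = L" and p: "regs c ''p'' = p" and W: "regs c ''W'' = w" and s: "s = 2 ^ w" "regs c ''s'' = s"
    and T: "regs c ''T'' = T"
    and start: "regs c ''l'' = 0" "regs c ''pos'' = 0" "regs c ''lo'' = 0" "regs c ''qlo'' = 0" "regs c ''E'' = 0"
    and h0: "holds A b (arrs c) 0 (level A s p 0)"
    and Z: "\<And>l. l \<le> L \<Longrightarrow> length (level A s p l) < Z" "n < Z" "L < Z" "w < Z"
  shows "run refute_part c (\<lambda>t c'. t \<le> 300 * Z * Z * Z * Z \<and>
    (if (\<Sum>T\<leftarrow>level A s p L. sg (rhs b T)) * real s \<le> real (m * s ^ L)
     then regs c' ''num'' = T + 5 \<and> regs c' ''den'' = 2 * T
     else regs c' ''num'' = regs c ''num'' \<and> regs c' ''den'' = regs c ''den''))"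
proof -
  have dim: "dim_row A = m" "dim_col A = n" using A by simp_all
  have mZ: "m < Z" using Z(1)[of 0] by (simp add: dim)
  have ZZ: "1 \<le> Z * (Z * (Z * Z))" "Z \<le> Z * (Z * (Z * Z))" using Z by (simp_all add: Suc_le_eq)
  show ?thesis
    unfolding refute_part_def
    apply simp
    apply (rule run_frame[OF run_size_loop[where m = m and n = n and Z = Z]])
         apply (simp_all add: m n start mZ)[5]
    apply (simp add: frame_no_arrs m)
    apply (rule run_frame[OF run_level_loop[where A = A and b = b and L = L and p = p and w = w and s = s and Z = Z]])
                      apply (simp_all add: dim n L p W s start Z)[15]
         apply (simp_all add: dim h0[simplified dim] Z[unfolded dim] del: level.simps)
    subgoal premises prems for t1 c1 t2 c2
      using prems s(2) T n m
      apply (simp add: frame_def del: level.simps)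
      apply (rule run_frame[OF run_final_loop[where b = b and A = A and lo = "regs c2 ''lo''" and xs = "level A s p L" and s = s and Z = Z]])
            apply (simp_all add: Z del: level.simps)[6]
      apply (simp add: frame_no_arrs del: level.simps)
      subgoal premises prems for t3
      proof -
        have "t1 \<le> 11 * Z" "t2 \<le> 215 * Z * Z * Z * Z" "t3 \<le> 15 * Z" using prems by blast+
        then show ?thesis
          using ZZ by (intro conjI impI) (simp_all only: mult.assoc)
      qed
      done
    done
qed

text \<open>Level lengths are bounded only under the guard, since otherwise no level is
  built.\<close>

lemma run_algorithm:
  fixes A :: "bit mat" and n Z :: nat
  defines "j \<equiv> extra n + 1"
  defines "p \<equiv> blocks n (2 * j)" and "s \<equiv> 2 ^ 16 ^ j"
  assumes A: "A \<in> carrier_mat m n" and b: "b \<in> carrier_vec m"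
    and Z: "n < Z" "m < Z" "8 * 24 ^ j < Z"
      "\<And>l. 2 ^ (8 * 24 ^ j + p) \<le> m \<Longrightarrow> l \<le> 2 * j \<Longrightarrow> length (level A s p l) < Z"
  shows "run algorithm (input A b r) (\<lambda>t c'. t \<le> 460 * Z * Z * Z * Z \<and>
    (if 2 ^ (8 * 24 ^ j + p) \<le> m \<and>
       (\<Sum>T\<leftarrow>level A s p (2 * j). sg (rhs b T)) * real s \<le> real (m * s ^ (2 * j))
     then regs c' ''num'' = 2 ^ 4 ^ j + 5 \<and> regs c' ''den'' = 2 * 2 ^ 4 ^ j
     else regs c' ''num'' = 1 \<and> regs c' ''den'' = 1))"
proof -
  let ?c = "input A b r"
  have dim: "dim_row A = m" "dim_col A = n" "dim_vec b = m" using A b by simp_all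
  have c: "regs ?c = (\<lambda>_. 0)(''m'' := m, ''n'' := n)"
    by (simp add: input_def dim)
  have Z': "16 ^ j < Z" "2 * j < Z"
    using param_bounds[of j] Z by simp_all
  have ZZ: "1 \<le> Z * (Z * (Z * Z))" "Z \<le> Z * (Z * (Z * Z))" using Z by (simp_all add: Suc_le_eq)
  have h0: "holds A b (arrs ?c) 0 (level A s p 0)"
  proof -
    have "i * n + k < m * n" "(i * n + k) div n = i" "(i * n + k) mod n = k" if "i < m" "k < n" for i k
      using that address_less[of i m k n] by simp_all
    then show ?thesis
      by (auto simp: holds_def input_def dim rhs_def coord_def)
  qed
  show ?thesis
    unfolding algorithm_def run_Seq
  proof (rule run_frame[OF run_setup_part[of ?c n Z, folded j_def]])
    fix t1 c1
    assume p1: "t1 \<le> 150 * Z \<and> regs c1 ''num'' = 1 \<and> regs c1 ''den'' = 1 \<and>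
      regs c1 ''T'' = 2 ^ 4 ^ j \<and> regs c1 ''W'' = 16 ^ j \<and> regs c1 ''L'' = 2 * j \<and> regs c1 ''s'' = 2 ^ 16 ^ j \<and>
      regs c1 ''p'' = blocks n (2 * j) \<and> regs c1 ''Q'' = 2 ^ (8 * 24 ^ j + blocks n (2 * j))"
      and fr: "frame setup_part ?c c1"
    note fr' = fr[unfolded frame_no_arrs[OF written_setup_part(2)]]
    let ?Q = "\<lambda>t c'. t \<le> 460 * Z * Z * Z * Z \<and>
      (if 2 ^ (8 * 24 ^ j + p) \<le> m \<and>
         (\<Sum>T\<leftarrow>level A s p (2 * j). sg (rhs b T)) * real s \<le> real (m * s ^ (2 * j))
       then regs c' ''num'' = 2 ^ 4 ^ j + 5 \<and> regs c' ''den'' = 2 * 2 ^ 4 ^ j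
       else regs c' ''num'' = 1 \<and> regs c' ''den'' = 1)"
    have regs1: "regs c1 ''m'' = m" "regs c1 ''n'' = n" "regs c1 ''l'' = 0" "regs c1 ''pos'' = 0" "regs c1 ''lo'' = 0"
      "regs c1 ''qlo'' = 0" "regs c1 ''E'' = 0"
      using fr' by (simp_all add: c)
    show "run (Cond (Less (Reg ''m'') (Reg ''Q'')) Skip refute_part) c1 (\<lambda>t'. ?Q (t1 + t'))"
    proof (cases "2 ^ (8 * 24 ^ j + p) \<le> m")
      case False
      have "t1 \<le> 150 * Z" using p1 by blast
      then have "t1 + 4 \<le> 460 * Z * Z * Z * Z"
        using ZZ by (simp only: mult.assoc)
      then show ?thesis
        using p1 False by (simp add: regs1 p_def)
    next
      case True
      have "run refute_part c1 (\<lambda>t c'. t \<le> 300 * Z * Z * Z * Z \<and>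
        (if (\<Sum>T\<leftarrow>level A s p (2 * j). sg (rhs b T)) * real s \<le> real (m * s ^ (2 * j))
         then regs c' ''num'' = 2 ^ 4 ^ j + 5 \<and> regs c' ''den'' = 2 * 2 ^ 4 ^ j
         else regs c' ''num'' = regs c1 ''num'' \<and> regs c' ''den'' = regs c1 ''den''))"
      proof (rule run_refute_part[OF A regs1(1,2), where w = "16 ^ j" and p = p and L = "2 * j" and s = s])
        show "regs c1 ''L'' = 2 * j" "regs c1 ''W'' = 16 ^ j" "regs c1 ''T'' = 2 ^ 4 ^ j"
          using p1 by blast+
        show "regs c1 ''p'' = p" "s = 2 ^ 16 ^ j" "regs c1 ''s'' = s"
          using p1 by (simp_all only: p_def s_def)
        show "holds A b (arrs c1) 0 (level A s p 0)"
          using h0 fr' by (simp only:)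
        show "length (level A s p l) < Z" if "l \<le> 2 * j" for l
          using Z(4) True that .
      qed (use regs1 Z Z' in \<open>simp_all only:\<close>)
      then have "run refute_part c1 (\<lambda>t' c'. ?Q (t1 + (3 + t')) c')"
      proof (rule run_frame, goal_cases)
        case (1 t c')
        have "t \<le> 300 * Z * Z * Z * Z" "t1 \<le> 150 * Z" using 1 p1 by blast+
        then have "t1 + (3 + t) \<le> 460 * Z * Z * Z * Z"
          using ZZ by (simp only: mult.assoc)
        then show ?case
          using 1(1) p1 True by (simp del: level.simps)
      qed
      moreover have "\<not> bval (Less (Reg ''m'') (Reg ''Q'')) c1" "bcost (Less (Reg ''m'') (Reg ''Q'')) = 3"
        using True p1 by (simp_all add: regs1 p_def)
      ultimately show ?thesis
        by (simp only: run_Cond if_False)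
    qed
  qed (use Z c in simp_all)
qed

section \<open>Exponent estimates for the chosen parameters\<close>

section \<open>Parameters\<close>

text \<open>The left-hand side collects the exponents to be paid for:
  \<open>16 ^ j * (2 * j)\<close> for \<open>s ^ L\<close>, \<open>2 * 16 ^ j\<close> for
  \<open>s ^ 2\<close>, and \<open>3 * j\<close> for \<open>2 ^ L\<close> and a failure probability
  of \<open>(1 / 2) ^ j\<close>. It serves the level lengths, the size condition and the failure
  bound.\<close>

lemma U_large:
  fixes j :: nat
  shows "16 ^ j * (2 * j) + 2 * 16 ^ j + 3 * j \<le> 8 * 24 ^ j"
proof (induction j)
  case (Suc j)
  have "j < 2 ^ j" by (rule less_exp)
  also have "(2::nat) ^ j \<le> 16 ^ j" by (rule power_mono) auto
  finally have j: "j + 1 \<le> 16 ^ j" by simp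
  show ?case
  \<comment> \<open>From 2 on, one step multiplies the left-hand side by at most 24.\<close>
  proof (cases "j \<ge> 2")
    case True
    then have 1: "2 * 16 ^ j \<le> 16 ^ j * j" by simp
    have 2: "16 * 16 ^ j * (2 * Suc j) = 32 * (16 ^ j * j) + 32 * 16 ^ j" "16 ^ j * (2 * j) = 2 * (16 ^ j * j)"
      "16 ^ Suc j = 16 * (16 ^ j :: nat)" "8 * 24 ^ Suc j = 24 * (8 * 24 ^ j :: nat)"
      by (simp_all add: algebra_simps)
    have "32 * a + 32 * x + 2 * (16 * x) + 3 * Suc j \<le> 24 * (8 * y)"
      if "2 * a + 2 * x + 3 * j \<le> 8 * y" "2 * x \<le> a" "j + 1 \<le> x" for a x y :: nat
    proof -
      have "24 * (2 * a + 2 * x + 3 * j) \<le> 24 * (8 * y)"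
        using that(1) by (rule mult_le_mono2)
      moreover have "32 * a + 32 * x + 2 * (16 * x) + 3 * Suc j \<le> 24 * (2 * a + 2 * x + 3 * j)"
        using that(2,3) by simp
      ultimately show ?thesis by (rule order_trans[rotated])
    qed
    from this[of "16 ^ j * j" "16 ^ j" "24 ^ j"] show ?thesis
      using Suc 1 j unfolding 2 by blast
  next
    case False
    then have "j = 0 \<or> j = 1" by auto
    then show ?thesis by auto
  qed
qed simp

lemma log2_square_le:
  assumes "n \<ge> 2"
  shows "(log 2 (real n))\<^sup>2 \<le> 3 * n"
proof -
  have n: "real n > 0" using assms by simp
  \<comment> \<open>Dividing by \<open>exp 1\<close> first improves the bound on
    \<open>ln (sqrt n)\<close> from \<open>sqrt n - 1\<close> to
    \<open>sqrt n / exp 1\<close>.\<close>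
  have "ln (sqrt n / exp 1) \<le> sqrt n / exp 1 - 1"
    using n by (intro ln_le_minus_one) simp
  then have "ln (sqrt n) \<le> sqrt n / exp 1"
    using n by (simp add: ln_div)
  also have "\<dots> \<le> sqrt n / 2"
    using exp_ge_add_one_self[of 1] by (intro divide_left_mono) auto
  finally have "ln n \<le> sqrt n"
    using n by (simp add: ln_sqrt)
  moreover have "ln 2 \<ge> (2 / 3 :: real)" by (rule ln2_ge_two_thirds)
  ultimately have "log 2 n \<le> sqrt n / (2 / 3)"
    using n unfolding log_def by (intro frac_le) auto
  then have "(log 2 n)\<^sup>2 \<le> (sqrt n / (2 / 3))\<^sup>2"
    using assms by (intro power_mono) auto
  then show ?thesis
    using n by (simp add: power_divide power2_eq_square)
qed

text \<open>Running time must be polynomial in \<open>m\<close> alone, so \<open>n\<close> has to be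
  bounded by \<open>m\<close>.\<close>

lemma n_le_m:
  assumes "n \<ge> 2" and m: "real m \<ge> 2 powr (3 * real n / log 2 (real n))"
  shows "n \<le> m"
proof -
  have "log 2 (real n) > 0" using assms by simp
  then have "log 2 (real n) \<le> 3 * real n / log 2 (real n)"
    using log2_square_le[OF assms(1)] by (simp add: field_simps power2_eq_square)
  then have "2 powr log 2 (real n) \<le> 2 powr (3 * real n / log 2 (real n))"
    by (intro powr_mono) auto
  then show ?thesis
    using m assms(1) by simp
qed

text \<open>\<open>setup_part\<close> runs before the guard is tested, and computing
  \<open>2 ^ U\<close> takes \<open>U\<close> rounds; a linear bound in \<open>n\<close> keeps this
  polynomial.\<close>

lemma U_le:
  shows "8 * 24 ^ (extra n + 1) \<le> 192 + 8 * n"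
proof (cases "extra n = 0")
  case False
  then have "32 ^ (extra n - 1 + 2) \<le> n" by (intro extra(2)) simp
  moreover have "extra n - 1 + 2 = extra n + 1" using False by simp
  moreover have "(24::nat) ^ (extra n + 1) \<le> 32 ^ (extra n + 1)" by (rule power_mono) auto
  ultimately show ?thesis by simp
qed simp

text \<open>The constant 3 enters here. With \<open>L = 2 * j\<close> and
  \<open>log 2 n \<le> 5 * (j + 1)\<close>, the leading term \<open>n / (2 * j)\<close> fits below
  \<open>3 * n / (5 * (j + 1))\<close> because \<open>1 / 2 < 3 / 5\<close>; the slack absorbs
  \<open>U \<le> 8 * (3 / 4) ^ j * n\<close> and the rounding of the block width.\<close>

lemma eventually_exponent_le:
  "\<exists>n0. \<forall>n\<ge>n0. real (8 * 24 ^ (extra n + 1) + blocks n (2 * (extra n + 1))) \<le> 3 * real n / log 2 (real n)"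
proof -
  have "\<forall>\<^sub>F j :: nat in at_top. 8 * (3 / 4) ^ j + (1 / (2 * real j) + 1 / 32 ^ j) \<le> 3 / (5 * (real j + 1))"
  proof -
    \<comment> \<open>The budget \<open>3 / 5\<close> is split as
      \<open>1 / 40 + 11 / 20 + 1 / 40\<close>, with the middle share above
      \<open>1 / 2\<close>.\<close>
    have 1: "\<forall>\<^sub>F j :: nat in at_top. 8 * (3 / 4) ^ j \<le> 1 / (40 * (real j + 1))"
      and 2: "\<forall>\<^sub>F j :: nat in at_top. 1 / (2 * real j) \<le> 11 / (20 * (real j + 1))"
      and 3: "\<forall>\<^sub>F j :: nat in at_top. 1 / 32 ^ j \<le> 1 / (40 * (real j + 1))"
      by real_asymp+
    show ?thesis
      using 1 2 3
    proof eventually_elim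
      case (elim j)
      have "1 / (40 * (real j + 1)) + (11 / (20 * (real j + 1)) + 1 / (40 * (real j + 1))) = 3 / (5 * (real j + 1))"
        by (simp add: divide_simps) (simp add: algebra_simps)
      then show ?case
        using add_mono[OF elim(1) add_mono[OF elim(2,3)]] by simp
    qed
  qed
  then obtain j0 where j0: "\<And>j. j \<ge> j0 \<Longrightarrow> 8 * (3 / 4) ^ j + (1 / (2 * real j) + 1 / 32 ^ j) \<le> 3 / (5 * (real j + 1))"
    unfolding eventually_at_top_linorder by blast
  show ?thesis
  proof (intro exI allI impI)
    fix n :: nat assume n: "n \<ge> 32 ^ (j0 + 2)"
    define j where "j = extra n + 1"
    have n1: "n < 32 ^ (j + 1)" using extra(1)[of n] by (simp add: j_def)
    have "(32::nat) ^ (j0 + 2) < 32 ^ (j + 1)" using n n1 by (rule le_less_trans)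
    then have "j0 + 2 < j + 1" by (rule power_less_imp_less_exp[rotated]) simp
    then have j: "j0 \<le> j" "extra n \<noteq> 0" "j > 0" by (auto simp: j_def)
    have "32 ^ (extra n - 1 + 2) \<le> n" using j by (intro extra(2)) simp
    moreover have "extra n - 1 + 2 = j" using j by (simp add: j_def)
    ultimately have n2: "32 ^ j \<le> n" by (simp only:)
    then have n2': "(32::real) ^ j \<le> n" by (metis of_nat_le_iff of_nat_numeral of_nat_power)
    have npos: "real n > 1" using n2' j by (smt (verit) one_less_power)
    have "log 2 n \<le> log 2 (32 ^ (j + 1))"
    proof -
      have "real n \<le> real (32 ^ (j + 1))"
        unfolding of_nat_le_iff using n1 by simp
      then show ?thesis using npos by simp
    qed
    also have "\<dots> = real (j + 1) * log 2 (2 ^ 5)"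
      by (subst log_nat_power) auto
    also have "\<dots> = 5 * (real j + 1)"
      by (simp add: log_nat_power del: power_numeral)
    finally have log: "log 2 n \<le> 5 * (real j + 1)" .
    have "(24::real) ^ j = (3 / 4) ^ j * 32 ^ j"
      by (simp flip: power_mult_distrib)
    also have "\<dots> \<le> (3 / 4) ^ j * n"
      using n2' by (intro mult_left_mono) auto
    finally have U: "real (8 * 24 ^ j) \<le> 8 * (3 / 4) ^ j * n" by simp
    have "blocks n (2 * j) - 1 < blocks n (2 * j) \<or> blocks n (2 * j) = 0" by auto
    then have "(blocks n (2 * j) - 1) * (2 * j) \<le> n"
      using blocks(2)[of "2 * j" "blocks n (2 * j) - 1" n] j by auto
    then have "real (blocks n (2 * j) - 1) * (2 * j) \<le> n"
      by (metis of_nat_le_iff of_nat_mult)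
    then have "real (blocks n (2 * j) - 1) \<le> n / (2 * real j)"
      using j by (simp add: field_simps)
    moreover have "real (blocks n (2 * j)) \<le> real (blocks n (2 * j) - 1) + 1" by simp
    \<comment> \<open>The 1 lost by rounding up is charged to \<open>n / 32 ^ j\<close>.\<close>
    moreover have "1 \<le> n / 32 ^ j" using n2' by simp
    ultimately have "real (blocks n (2 * j)) \<le> n / (2 * real j) + n / 32 ^ j"
      by linarith
    then have p: "real (blocks n (2 * j)) \<le> n * (1 / (2 * real j) + 1 / 32 ^ j)"
      by (simp add: distrib_left)
    have "real (8 * 24 ^ j + blocks n (2 * j)) \<le> n * (8 * (3 / 4) ^ j + (1 / (2 * real j) + 1 / 32 ^ j))"
      using U p by (simp add: algebra_simps)
    also have "\<dots> \<le> n * (3 / (5 * (real j + 1)))"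
      by (intro mult_left_mono j0 j) simp
    also have "\<dots> \<le> n * (3 / log 2 n)"
      using log npos by (intro mult_left_mono divide_left_mono) auto
    finally show "real (8 * 24 ^ (extra n + 1) + blocks n (2 * (extra n + 1))) \<le> 3 * real n / log 2 (real n)"
      by (simp add: j_def mult.commute)
  qed
qed

text \<open>From \<open>n < 32 ^ (j + 1)\<close> one gets
  \<open>n powr (1 / 20) \<le> 2 ^ j\<close>, and \<open>2 ^ j + 2 \<le> 4 ^ j\<close> leaves a
  factor 4 to absorb \<open>5 / 2\<close>.\<close>

lemma value_le:
  fixes n :: nat
  defines "j \<equiv> extra n + 1"
  shows "5 / 2 * (1 / 2 ^ 4 ^ j) \<le> 2 powr (- (real n powr (1 / 20)))"
proof -
  have "real n \<le> real (32 ^ (j + 1))"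
    unfolding of_nat_le_iff using extra(1)[of n] by (simp add: j_def)
  then have "real n \<le> 32 ^ (j + 1)" by simp
  also have "(32::real) ^ (j + 1) = 2 powr (5 * (real j + 1))"
  proof -
    have "(32::real) ^ (j + 1) = (2 ^ 5) ^ (j + 1)" by simp
    also have "\<dots> = 2 ^ (5 * (j + 1))" by (simp only: power_mult)
    also have "\<dots> = 2 powr real (5 * (j + 1))" by (subst powr_realpow) auto
    finally show ?thesis by (simp add: algebra_simps)
  qed
  finally have "real n powr (1 / 20) \<le> (2 powr (5 * (real j + 1))) powr (1 / 20)"
    by (intro powr_mono2) auto
  also have "\<dots> = 2 powr ((real j + 1) / 4)"
  proof -
    have "5 * (real j + 1) * (1 / 20) = (real j + 1) / 4" by simp
    then show ?thesis by (simp only: powr_powr)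
  qed
  also have "\<dots> \<le> 2 powr real j"
    by (intro powr_mono) (auto simp: j_def)
  also have "\<dots> = 2 ^ j"
    by (simp add: powr_realpow)
  finally have n: "real n powr (1 / 20) \<le> 2 ^ j" .
  have "(2::nat) ^ j + 2 ^ j \<le> 2 ^ j * 2 ^ j"
    by (simp add: j_def flip: mult_2)
  moreover have "(2::nat) \<le> 2 ^ j" by (simp add: j_def)
  moreover have "(4::nat) ^ j = 2 ^ j * 2 ^ j"
    by (simp flip: power_mult_distrib)
  ultimately have "2 ^ j + 2 \<le> (4::nat) ^ j" by simp
  then have "(2::real) ^ (2 ^ j + 2) \<le> 2 ^ 4 ^ j"
    by (intro power_increasing) auto
  then have "4 * 2 ^ 2 ^ j \<le> (2::real) ^ 4 ^ j"
    by (simp add: power_add)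
  moreover have "5 / 2 * 2 ^ 2 ^ j \<le> 4 * (2::real) ^ 2 ^ j" by simp
  ultimately have "5 / 2 * 2 ^ 2 ^ j \<le> (2::real) ^ 4 ^ j" by linarith
  then have "5 / 2 * (1 / 2 ^ 4 ^ j) \<le> 1 / (2::real) ^ 2 ^ j"
    by (simp add: field_simps)
  also have "\<dots> = 2 powr - (2 ^ j)"
    by (simp add: powr_minus_divide powr_realpow[symmetric])
  also have "\<dots> \<le> 2 powr (- (real n powr (1 / 20)))"
    using n by (intro powr_mono) auto
  finally show ?thesis .
qed

lemma filterlim_extra: "filterlim extra at_top sequentially"
  unfolding filterlim_at_top eventually_sequentially
proof (intro allI exI impI)
  fix k n :: nat assume "n \<ge> 32 ^ (k + 2)"
  then have "(32::nat) ^ (k + 2) < 32 ^ (extra n + 2)"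
    using extra(1)[of n] by (rule le_less_trans)
  then have "k + 2 < extra n + 2" by (rule power_less_imp_less_exp[rotated]) simp
  then show "k \<le> extra n" by simp
qed

section \<open>Guarantees for every input and for random right-hand sides\<close>

lemma val_le_1:
  assumes A: "A \<in> carrier_mat m n" and "m > 0"
  shows "val A b \<le> 1"
proof -
  have "sg a \<le> 1" for a by (simp add: sg_def)
  then have "(\<Sum>i<m. sg (scalar_prod (row A i) x + vec_index b i)) \<le> (\<Sum>i<m. 1)" for x :: "bit vec"
    by (intro sum_mono)
  then show ?thesis
    using val_le[OF A \<open>m > 0\<close>, of b "1 / 2"] by simp
qed

lemma outputs_algorithm:
  fixes A :: "bit mat" and n m :: nat
  defines "j \<equiv> extra n + 1"
  defines "p \<equiv> blocks n (2 * j)" and "s \<equiv> 2 ^ 16 ^ j"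
  assumes A: "A \<in> carrier_mat m n" and b: "b \<in> carrier_vec m" and nm: "n \<le> m" "0 < m"
  defines "accept \<equiv> 2 ^ (8 * 24 ^ j + p) \<le> m \<and>
    (\<Sum>T\<leftarrow>level A s p (2 * j). sg (rhs b T)) * real s \<le> real (m * s ^ (2 * j))"
  defines "\<V> \<equiv> (if accept then 1 / 2 + 5 / 2 * (1 / 2 ^ 4 ^ j) else 1)"
  shows "\<exists>t. outputs algorithm A b r t \<V> \<and> t \<le> poly ([:460:] * ([:1:] + monom 200 2) ^ 4) m"
    and "\<V> \<in> {1 / 2..1}" and "val A b \<le> \<V>"
proof -
  \<comment> \<open>This exceeds \<open>192 + 8 * n\<close>, hence \<open>U\<close>, and also
    \<open>m * m\<close>, which bounds every level once the guard gives
    \<open>s ^ l \<le> m\<close>.\<close>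
  define Z where "Z = 1 + 200 * m\<^sup>2"
  have m2: "m \<le> m\<^sup>2" using nm by (simp add: power2_eq_square)
  have U: "16 ^ j * (2 * j) + 2 * 16 ^ j + 3 * j \<le> 8 * 24 ^ j" by (rule U_large)
  have Z: "n < Z" "m < Z" "8 * 24 ^ j < Z"
    using m2 nm U_le[of n] unfolding Z_def j_def by linarith+
  have s: "s > 0" by (simp add: s_def)
  have len: "length (level A s p l) < Z" if fits: "2 ^ (8 * 24 ^ j + p) \<le> m" and l: "l \<le> 2 * j" for l
  proof -
    have "s ^ l \<le> s ^ (2 * j)" using s l by (intro power_increasing) auto
    also have "\<dots> = 2 ^ (16 ^ j * (2 * j))" by (simp add: s_def power_mult)
    also have "\<dots> \<le> 2 ^ (8 * 24 ^ j + p)" using U by (intro power_increasing) auto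
    also have "\<dots> \<le> m" by fact
    finally have "m * s ^ l \<le> m * m" by (rule mult_le_mono2)
    moreover have "length (level A s p l) \<le> m * s ^ l"
      using length_level[OF s, of A p l] A by simp
    ultimately have "length (level A s p l) \<le> m * m" by linarith
    then show ?thesis by (simp add: Z_def power2_eq_square)
  qed
  have "run algorithm (input A b r) (\<lambda>t c'. t \<le> 460 * Z * Z * Z * Z \<and>
    (if accept then regs c' ''num'' = 2 ^ 4 ^ j + 5 \<and> regs c' ''den'' = 2 * 2 ^ 4 ^ j
     else regs c' ''num'' = 1 \<and> regs c' ''den'' = 1))"
    unfolding accept_def p_def s_def j_def
    by (rule run_algorithm[OF A b]) (use Z len in \<open>unfold p_def s_def j_def, blast+\<close>)
  then obtain t c' where t: "exec algorithm (input A b r) t c'" "t \<le> 460 * Z * Z * Z * Z"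
    and c': "if accept then regs c' ''num'' = 2 ^ 4 ^ j + 5 \<and> regs c' ''den'' = 2 * 2 ^ 4 ^ j
     else regs c' ''num'' = 1 \<and> regs c' ''den'' = 1"
    unfolding run_def by blast
  have "\<V> = real (regs c' ''num'') / real (regs c' ''den'')" "regs c' ''den'' \<noteq> 0"
    using c' by (auto simp: \<V>_def field_simps split: if_splits)
  moreover have "poly ([:460:] * ([:1:] + monom 200 2) ^ 4) m = 460 * Z ^ 4"
    by (simp only: poly_mult poly_power poly_add poly_monom poly_pCons poly_0 Z_def) simp
  then have "poly ([:460:] * ([:1:] + monom 200 2) ^ 4) m = 460 * Z * Z * Z * Z"
    by (simp only: power4_eq_xxxx mult.assoc)
  ultimately show "\<exists>t. outputs algorithm A b r t \<V> \<and> t \<le> poly ([:460:] * ([:1:] + monom 200 2) ^ 4) m"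
    using t unfolding outputs_def by metis
  \<comment> \<open>\<open>5 \<le> 2 ^ 4\<close> keeps the certified value at most 1.\<close>
  have "(2::real) ^ 4 \<le> 2 ^ 4 ^ j"
  proof (rule power_increasing)
    show "(4::nat) \<le> 4 ^ j" by (simp add: j_def)
  qed simp
  then have "5 / 2 * (1 / 2 ^ 4 ^ j) \<le> (1 / 2 :: real)"
    by (simp add: field_simps)
  then show "\<V> \<in> {1 / 2..1}"
    by (cases accept) (simp_all add: \<V>_def field_simps)
  show "val A b \<le> \<V>"
  proof (cases accept)
    case False
    then show ?thesis
      using val_le_1[OF A nm(2)] by (simp add: \<V>_def)
  next
    case True
    have G: "2 ^ (2 * j) = (4::nat) ^ j" by (simp add: power_mult)
    have w: "(16::nat) ^ j = 2 ^ (2 * j) * 2 ^ (2 * j)"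
      unfolding G by (simp flip: power_mult_distrib)
    have "s * 2 ^ (2 * j) * 2 ^ p = 2 ^ (16 ^ j + 2 * j + p)"
      by (simp add: s_def power_add)
    also have "\<dots> \<le> 2 ^ (8 * 24 ^ j + p)"
      using U by (intro power_increasing) auto
    also have "\<dots> \<le> m" using True by (simp add: accept_def)
    finally have size: "s * 2 ^ (2 * j) * 2 ^ p \<le> m" .
    have "val A b \<le> 1 / 2 + 5 / 2 * (1 / 2 ^ 2 ^ (2 * j))"
    proof (rule certificate[OF A _ size])
      show "s = 2 ^ (2 ^ (2 * j) * 2 ^ (2 * j))"
        by (simp only: s_def w)
      show "n \<le> 2 * j * p"
        using blocks(1)[of "2 * j" n] by (simp add: p_def j_def mult.commute)
      show "(\<Sum>T\<leftarrow>level A s p (2 * j). sg (rhs b T)) * s \<le> m * s ^ (2 * j)"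
        using True by (simp only: accept_def)
    qed
    then show ?thesis
      using True by (simp add: \<V>_def G)
  qed
qed

text \<open>The failure bound \<open>2 ^ L * s ^ 2 / m\<close> of \<open>card_failures\<close> is
  small because \<open>U_large\<close> leaves a spare factor \<open>2 ^ j\<close> in
  \<open>m\<close>.\<close>

lemma prob_accept:
  fixes A :: "bit mat" and n m :: nat
  defines "j \<equiv> extra n + 1"
  defines "p \<equiv> blocks n (2 * j)" and "s \<equiv> 2 ^ 16 ^ j"
  assumes A: "A \<in> carrier_mat m n" and size: "2 ^ (8 * 24 ^ j + p) \<le> m"
  shows "measure_pmf.prob (pmf_of_set (carrier_vec m))
    {b. \<not> (\<Sum>T\<leftarrow>level A s p (2 * j). sg (rhs b T)) * real s \<le> real (m * s ^ (2 * j))} \<le> (1 / 2) ^ j"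
proof -
  let ?C = "carrier_vec m :: bit vec set"
  let ?B = "{b. \<not> (\<Sum>T\<leftarrow>level A s p (2 * j). sg (rhs b T)) * real s \<le> real (m * s ^ (2 * j))}"
  have ne: "?C \<noteq> {}" using zero_carrier_vec by blast
  have C: "card ?C > 0" using ne finite_carrier_vec_bit by (simp add: card_gt_0_iff)
  have "(2::nat) ^ 0 < 2 ^ (8 * 24 ^ j + p)"
    by (rule power_strict_increasing) auto
  then have m: "m > 0" using size by simp
  have s: "s > 0" by (simp add: s_def)
  have "real (card (?C \<inter> ?B)) * m \<le> card ?C * (2 ^ (2 * j) * real s ^ 2)"
    using card_failures[OF A s m, where p = p and L = "2 * j"]
    by (simp add: Int_def conj_commute)
  then have "real (card (?C \<inter> ?B)) / card ?C \<le> 2 ^ (2 * j) * real s ^ 2 / m"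
    using C m by (simp add: field_simps)
  also have "\<dots> \<le> (1 / 2) ^ j"
  proof -
    have "2 ^ (2 * j) * s ^ 2 * 2 ^ j = 2 ^ (2 * j + 16 ^ j * 2 + j)"
      by (simp only: s_def power_add power_mult[of _ "16 ^ j"])
    also have "\<dots> \<le> (2::nat) ^ (8 * 24 ^ j + p)"
      using U_large[of j] by (intro power_increasing) auto
    also have "\<dots> \<le> m" by fact
    finally have "real (2 ^ (2 * j) * s ^ 2 * 2 ^ j) \<le> m"
      by (simp only: of_nat_le_iff)
    then show ?thesis
      using m by (simp add: field_simps)
  qed
  finally show ?thesis
    using measure_pmf_of_set[OF ne finite_carrier_vec_bit, of ?B] by simp
qed

text \<open>Acceptance depends on \<open>b\<close> only, and the accepted value suits the smallest
  admissible \<open>\<epsilon>\<close>; hence the same event serves every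
  \<open>\<epsilon>\<close>.\<close>

theorem theorem1p2:
  shows "\<exists>(alg :: com) (T :: nat poly) (\<delta> :: nat \<Rightarrow> real).
    \<delta> \<longlonglongrightarrow> 0 \<and>
    (\<forall>n m :: nat. n \<ge> 2 \<and> real m \<ge> 2 powr (3 * real n / log 2 (real n)) \<longrightarrow>
      (\<forall>A \<in> carrier_mat m n. \<forall>b \<in> carrier_vec m. \<forall>r. length r = poly T m \<longrightarrow>
        (\<exists>t \<V>. outputs alg A b r t \<V> \<and> t \<le> poly T m \<and> \<V> \<in> {1/2..1} \<and> val A b \<le> \<V>)) \<and>
      (\<forall>A \<in> carrier_mat m n. \<forall>\<epsilon> \<in> {2 powr (- (real n powr (1/20)))..1/2}.
        measure_pmf.prob (rhs_and_coins m (poly T m))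
          {(b, r). \<exists>t \<V>. outputs alg A b r t \<V> \<and> \<V> \<le> 1/2 + \<epsilon>} \<ge> 1 - \<delta> n))"
proof -
  let ?T = "[:460:] * ([:1:] + monom 200 2) ^ 4 :: nat poly"
  obtain n0 where n0: "\<And>n. n \<ge> n0 \<Longrightarrow>
      real (8 * 24 ^ (extra n + 1) + blocks n (2 * (extra n + 1))) \<le> 3 * real n / log 2 (real n)"
    using eventually_exponent_le by blast
  \<comment> \<open>Below \<open>n0\<close> the guard may fail although \<open>m\<close> meets the
    hypothesis; there the probability bound is the trivial \<open>0\<close>.\<close>
  define \<delta> where "\<delta> n = (if n < n0 then 1 else (1 / 2 :: real) ^ (extra n + 1))" for n
  have "(\<lambda>k. (1 / 2 :: real) ^ (k + 1)) \<longlonglongrightarrow> 0"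
    by real_asymp
  then have "(\<lambda>n. (1 / 2 :: real) ^ (extra n + 1)) \<longlonglongrightarrow> 0"
    using filterlim_extra by (rule filterlim_compose)
  then have \<delta>: "\<delta> \<longlonglongrightarrow> 0"
    by (rule Lim_transform_eventually) (auto simp: \<delta>_def eventually_sequentially intro!: exI[of _ n0])
  have correct: "\<exists>t \<V>. outputs algorithm A b r t \<V> \<and> t \<le> poly ?T m \<and> \<V> \<in> {1/2..1} \<and> val A b \<le> \<V>"
    if "n \<ge> 2" "real m \<ge> 2 powr (3 * real n / log 2 (real n))" "A \<in> carrier_mat m n" "b \<in> carrier_vec m" for n m A b r
    using outputs_algorithm[OF that(3,4) n_le_m[OF that(1,2)]] n_le_m[OF that(1,2)] that(1) by fastforce
  have prob: "measure_pmf.prob (rhs_and_coins m (poly ?T m))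
      {(b, r). \<exists>t \<V>. outputs algorithm A b r t \<V> \<and> \<V> \<le> 1/2 + \<epsilon>} \<ge> 1 - \<delta> n"
    if n: "n \<ge> 2" and m: "real m \<ge> 2 powr (3 * real n / log 2 (real n))" and A: "A \<in> carrier_mat m n"
      and \<epsilon>: "2 powr (- (real n powr (1/20))) \<le> \<epsilon>" for n m A \<epsilon>
  proof (cases "n < n0")
    case True
    then show ?thesis by (simp add: \<delta>_def)
  next
    case False
    let ?j = "extra n + 1"
    let ?p = "blocks n (2 * ?j)" and ?s = "2 ^ 16 ^ ?j :: nat"
    let ?B = "{b. \<not> (\<Sum>T\<leftarrow>level A ?s ?p (2 * ?j). sg (rhs b T)) * real ?s \<le> real (m * ?s ^ (2 * ?j))}"
    let ?C = "pmf_of_set (carrier_vec m :: bit vec set)"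
    let ?E = "{(b, r). \<exists>t \<V>. outputs algorithm A b r t \<V> \<and> \<V> \<le> 1/2 + \<epsilon>}"
    have nm: "n \<le> m" "0 < m" using n_le_m[OF n m] n by simp_all
    have "real (2 ^ (8 * 24 ^ ?j + ?p)) = 2 powr real (8 * 24 ^ ?j + ?p)"
      by (simp only: powr_realpow of_nat_power of_nat_numeral)
    also have "\<dots> \<le> 2 powr (3 * real n / log 2 (real n))"
      using n0[of n] False by (intro powr_mono) auto
    also have "\<dots> \<le> m" by fact
    finally have size: "2 ^ (8 * 24 ^ ?j + ?p) \<le> m"
      by (simp only: of_nat_le_iff)
    have ne: "(carrier_vec m :: bit vec set) \<noteq> {}" using zero_carrier_vec by blast
    have supp: "set_pmf (rhs_and_coins m (poly ?T m)) \<subseteq> carrier_vec m \<times> UNIV"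
      using set_pmf_of_set[OF ne finite_carrier_vec_bit] by (auto simp: rhs_and_coins_def)
    have good: "(b, r) \<in> ?E" if b: "b \<in> carrier_vec m" "b \<notin> ?B" for b r
    proof -
      have "\<exists>t. outputs algorithm A b r t (1 / 2 + 5 / 2 * (1 / 2 ^ 4 ^ ?j))"
        using outputs_algorithm(1)[OF A b(1) nm, of r] size b(2) by (auto simp del: power_Suc add_2_eq_Suc' level.simps)
      moreover have "5 / 2 * (1 / 2 ^ 4 ^ ?j) \<le> \<epsilon>"
        using value_le[of n] \<epsilon> by simp
      ultimately show ?thesis by force
    qed
    have "1 - \<delta> n \<le> 1 - measure_pmf.prob ?C ?B"
      using prob_accept[OF A size] False by (simp add: \<delta>_def)
    also have "\<dots> = measure_pmf.prob ?C (- ?B)"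
      by (subst measure_pmf.prob_compl[symmetric]) (auto simp: Compl_eq_Diff_UNIV)
    \<comment> \<open>Passing to the first marginal removes the coins.\<close>
    also have "\<dots> = measure_pmf.prob (map_pmf fst (rhs_and_coins m (poly ?T m))) (- ?B)"
      by (simp add: rhs_and_coins_def map_fst_pair_pmf)
    also have "\<dots> = measure_pmf.prob (rhs_and_coins m (poly ?T m)) (fst -` (- ?B))"
      by (rule measure_map_pmf)
    also have "\<dots> \<le> measure_pmf.prob (rhs_and_coins m (poly ?T m)) ?E"
    proof (rule measure_pmf.finite_measure_mono_AE)
      show "AE x in measure_pmf (rhs_and_coins m (poly ?T m)). x \<in> fst -` (- ?B) \<longrightarrow> x \<in> ?E"
        unfolding AE_measure_pmf_iff
      proof (intro ballI impI)
        fix x assume x: "x \<in> set_pmf (rhs_and_coins m (poly ?T m))" "x \<in> fst -` (- ?B)"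
        obtain b r where br: "x = (b, r)" by (cases x)
        have "b \<in> carrier_vec m"
          using subsetD[OF supp x(1)] by (simp only: br mem_Times_iff fst_conv)
        moreover have "b \<notin> ?B"
          using x(2) by (simp only: br vimage_eq fst_conv Compl_iff not_False_eq_True)
        ultimately show "x \<in> ?E"
          unfolding br by (rule good)
      qed
    qed simp
    finally show ?thesis .
  qed
  show ?thesis
  proof (rule exI[of _ algorithm], rule exI[of _ ?T], rule exI[of _ \<delta>], intro conjI allI impI)
    show "\<delta> \<longlonglongrightarrow> 0" by fact
  next
    fix n m :: nat
    assume nm: "n \<ge> 2 \<and> real m \<ge> 2 powr (3 * real n / log 2 (real n))"
    then show "\<forall>A \<in> carrier_mat m n. \<forall>b \<in> carrier_vec m. \<forall>r. length r = poly ?T m \<longrightarrow>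
        (\<exists>t \<V>. outputs algorithm A b r t \<V> \<and> t \<le> poly ?T m \<and> \<V> \<in> {1/2..1} \<and> val A b \<le> \<V>)"
      using correct by blast
    show "\<forall>A \<in> carrier_mat m n. \<forall>\<epsilon> \<in> {2 powr (- (real n powr (1/20)))..1/2}.
        measure_pmf.prob (rhs_and_coins m (poly ?T m))
          {(b, r). \<exists>t \<V>. outputs algorithm A b r t \<V> \<and> \<V> \<le> 1/2 + \<epsilon>} \<ge> 1 - \<delta> n"
    proof (intro ballI)
      fix A :: "bit mat" and \<epsilon> :: real
      assume A: "A \<in> carrier_mat m n" and \<epsilon>: "\<epsilon> \<in> {2 powr (- (real n powr (1/20)))..1/2}"
      show "measure_pmf.prob (rhs_and_coins m (poly ?T m))
          {(b, r). \<exists>t \<V>. outputs algorithm A b r t \<V> \<and> \<V> \<le> 1/2 + \<epsilon>} \<ge> 1 - \<delta> n"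
        using nm \<epsilon> by (intro prob A) (simp_all only: atLeastAtMost_iff)
    qed
  qed
qed

end
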